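(* Let $\pi_k$ be the current policy, let $h\in\mathcal H$ be a test function, let $\varepsilon$ be the risk budget, let $\delta\in(0,1)$ be a confidence level, let $\delta_{\mathrm{KL}}>0$ be a trust-region radius, and let $\lambda_k\ge 0$ be the Stein factor at iteration $k$. Suppose the policy $\pi_{k+1}$ satisfies the margined trust-region constraint $$C_h^{\pi_k}(\mu_0)+\sum_{t=0}^{H-1}\mathbb{E}_{\bar s\sim\bar d_t^{\pi_k},\,a\sim\pi_{k+1}(\cdot\mid s)}\big[A_{h,t}^{\pi_k}(\bar s,a)\big]+\lambda_k\,\underline{SD}_{\mathrm{tot}}^{+}(q_{\pi_k}\|p_{\mathrm{ref}})\le\varepsilon,\qquad \bar D_{\mathrm{KL}}(\pi_{k+1}\|\pi_k)\le\delta_{\mathrm{KL}} .$$ Suppose $\underline{SD}_{\mathrm{tot}}^{+}(q_{\pi_k}\|p_{\mathrm{ref}})>0$ and $$\lambda_k\;\ge\;\frac{2H\,\epsilon_h^{\pi_{k+1}}\displaystyle\sum_{t=0}^{H-1}\mathbb{E}_{\bar s\sim\bar d_t^{\pi_k}}\Big[D_{\mathrm{TV}}\big(\pi_{k+1}(\cdot\mid s),\pi_k(\cdot\mid s)\big)\Big]}{\underline{SD}_{\mathrm{tot}}^{+}(q_{\pi_k}\|p_{\mathrm{ref}})} .$$ Then, with probability at least $1-2\delta$, $$C_h^{\pi_{k+1}}(\mu_0)\le\varepsilon .$$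
   Context: CMDP. $\mathcal M=(\mathcal S,\mathcal A,P,r,c,H,\mu_0)$ is an episodic constrained Markov decision process with state space $\mathcal S$, action space $\mathcal A$, transition kernel $P(\cdot\mid s,a)$, reward $r$, per-step cost $c:\mathcal S\times\mathcal A\to[0,1]$, horizon $H$ and initial state distribution $\mu_0$. A policy $\pi(\cdot\mid s)$ is a stochastic map from states to actions; it generates trajectories $\tau=(s_0,a_0,\dots,s_{H-1},a_{H-1},s_H)$ with $s_0\sim\mu_0$, $a_t\sim\pi(\cdot\mid s_t)$, $s_{t+1}\sim P(\cdot\mid s_t,a_t)$. Put $C(\tau)=\sum_{t=0}^{H-1}c(s_t,a_t)$. $\mathcal H$ is a class of measurable test functions $h:\mathbb R\to\mathbb R$ (with all expectations below well defined), and $C_h^\pi(\mu_0)=\mathbb E_{\tau\sim\pi}[h(C(\tau))]$. Augmented process. The augmented state is $\bar s_t=(s_t,z_t)\in\mathcal S\times\mathbb R$ with $z_0=0$, $z_{t+1}=z_t+c(s_t,a_t)$; policies select actions from $s$ only ($s$ denotes the first component of $\bar s$). All per-step costs are $0$ and the terminal cost is $h(z_H)$, so that the expected total cost of $\pi$ is $C_h^\pi(\mu_0)$. For $0\le t\le H-1$ let $Q_{h,t}^{\pi}(\bar s,a)=\mathbb E_\pi[h(z_H)\mid\bar s_t=\bar s,a_t=a]$, $C_{h,t}^{\pi}(\bar s)=\mathbb E_\pi[h(z_H)\mid\bar s_t=\bar s]$, and $A_{h,t}^{\pi}=Q_{h,t}^{\pi}-C_{h,t}^{\pi}$. $\bar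 d_t^{\pi}$ is the distribution of $\bar s_t$ under $\pi$. $D_{\mathrm{TV}}$ is total variation distance, $D_{\mathrm{TV}}(\pi'(\cdot\mid s),\pi(\cdot\mid s))=\frac12\sum_a|\pi'(a\mid s)-\pi(a\mid s)|$. $\epsilon_h^{\pi_{k+1}}:=\max_{t,\bar s}\big|\mathbb E_{a\sim\pi_{k+1}(\cdot\mid s)}[A_{h,t}^{\pi_k}(\bar s,a)]\big|$. $\bar D_{\mathrm{KL}}(\pi\|\pi_k)$ is the average over states visited by $\pi_k$ of the KL divergence between $\pi(\cdot\mid s)$ and $\pi_k(\cdot\mid s)$. The quantity $\underline{SD}_{\mathrm{tot}}^{+}(q_{\pi_k}\|p_{\mathrm{ref}})$. Let $d>0$ be the cost limit, and let $c_1,\dots,c_n\in[0,1]$ be normalized clipped costs $\min\{C(\tau_i)/d,1\}$ of $n$ i.i.d. trajectories of $\pi_k$; $q_{\pi_k}$ is their common law. The reference is $p_{\mathrm{ref}}=a_0^\star\delta_0+a_1^\star\delta_1+(1-a_0^\star-a_1^\star)p_{\mathrm{int}}$ with $a_0^\star,a_1^\star\in[0,1]$ and $p_{\mathrm{int}}$ a smooth density on $(0,1)$. With small thresholds $\tau_0,\tau_1\ge0$, $\tau_0<1-\tau_1$, put $\hat a_0=\frac1n\sum_i\mathbf 1\{c_i\le\tau_0\}$, $\hat a_1=\frac1n\sum_i\mathbf 1\{c_i\ge1-\tau_1\}$, $\hat w=1-\hat a_0-\hat a_1$. Let $c^{\mathrm{int}}_1,\dots,c^{\mathrm{int}}_m$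 be the remaining (interior) samples, clipped away from $0$ and $1$. For a base kernel $k$ on $(0,1)$ and score $s=(\log p_{\mathrm{int}})'$, the Stein kernel is $u_{p_{\mathrm{int}}}(x,y)=s(x)k(x,y)s(y)+s(x)\partial_yk(x,y)+\partial_xk(x,y)s(y)+\partial_x\partial_yk(x,y)$, assumed to satisfy $|u_{p_{\mathrm{int}}}|\le M_u$ on clipped points. Put $\widehat{SD}_{\mathrm{int}}=\frac1{m^2}\sum_{i,j=1}^m u_{p_{\mathrm{int}}}(c_i^{\mathrm{int}},c_j^{\mathrm{int}})$, $\widehat{SD}_{\mathrm{tot}}=(a_0^\star-\hat a_0)_++(\hat a_1-a_1^\star)_++\hat w\,\widehat{SD}_{\mathrm{int}}$, $\epsilon_w(n,\delta)=2\sqrt{\log(6/\delta)/(2n)}$, $\epsilon_{\mathrm{int}}(m,\delta)=2\sqrt2\,M_u\sqrt{\log(6/\delta)/m}$, where $(x)_+=\max(x,0)$. Then $$\underline{SD}_{\mathrm{tot}}^{+}(q_{\pi_k}\|p_{\mathrm{ref}})=\max\Big\{0,\ \widehat{SD}_{\mathrm{tot}}-\epsilon_{\mathrm{int}}(m,\delta)-\epsilon_w(n,\delta)\big(1+\widehat{SD}_{\mathrm{int}}+\epsilon_{\mathrm{int}}(m,\delta)\big)\Big\}.$$ Probability is with respect to the rollout samples. *)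

theory Defs
  imports "HOL-Probability.Probability"
begin

section \<open>Constrained Markov decision processes, policies, trajectories\<close>

record ('s, 'a) cmdp =
  states :: "'s measure"
  actions :: "'a set"
  trans_kernel :: "'s \<Rightarrow> 'a \<Rightarrow> 's measure"
  reward :: "'s \<Rightarrow> 'a \<Rightarrow> real"
  cost :: "'s \<Rightarrow> 'a \<Rightarrow> real"
  horizon :: nat
  init_dist :: "'s measure"

text \<open>The state space is an arbitrary measurable space. The action space is discrete (countable,
  all subsets measurable), so that total variation is a sum over actions.\<close>

definition is_cmdp :: "('s, 'a) cmdp \<Rightarrow> bool" where
  "is_cmdp M \<longleftrightarrow>
     countable (actions M) \<and>
     case_prod (trans_kernel M)
       \<in> states M \<Otimes>\<^sub>M count_space (actions M) \<rightarrow>\<^sub>M prob_algebra (states M) \<and>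
     case_prod (reward M) \<in> borel_measurable (states M \<Otimes>\<^sub>M count_space (actions M)) \<and>
     case_prod (cost M) \<in> borel_measurable (states M \<Otimes>\<^sub>M count_space (actions M)) \<and>
     (\<forall>s\<in>space (states M). \<forall>a\<in>actions M. 0 \<le> cost M s a \<and> cost M s a \<le> 1) \<and>
     0 < horizon M \<and>
     init_dist M \<in> space (prob_algebra (states M))"

definition is_policy :: "('s, 'a) cmdp \<Rightarrow> ('s \<Rightarrow> 'a measure) \<Rightarrow> bool" where
  "is_policy M \<pi> \<longleftrightarrow> \<pi> \<in> states M \<rightarrow>\<^sub>M prob_algebra (count_space (actions M))"

text \<open>A trajectory of length \<open>T\<close> is a pair \<open>(ss, as)\<close> of a state sequence indexed by \<open>{..T}\<close> and
  an action sequence indexed by \<open>{..<T}\<close>.\<close>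

type_synonym ('s, 'a) traj = "(nat \<Rightarrow> 's) \<times> (nat \<Rightarrow> 'a)"

definition traj_space :: "('s, 'a) cmdp \<Rightarrow> nat \<Rightarrow> ('s, 'a) traj measure" where
  "traj_space M T =
     (\<Pi>\<^sub>M i\<in>{..T}. states M) \<Otimes>\<^sub>M (\<Pi>\<^sub>M i\<in>{..<T}. count_space (actions M))"

primrec traj_upto :: "('s, 'a) cmdp \<Rightarrow> ('s \<Rightarrow> 'a measure) \<Rightarrow> nat \<Rightarrow> ('s, 'a) traj measure" where
  "traj_upto M \<pi> 0 =
     do { s \<leftarrow> init_dist M;
          return (traj_space M 0) ((\<lambda>i\<in>{..0}. s), (\<lambda>i\<in>{..<0}. undefined)) }"
| "traj_upto M \<pi> (Suc t) =
     do { (ss, as) \<leftarrow> traj_upto M \<pi> t;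
          a \<leftarrow> \<pi> (ss t);
          s' \<leftarrow> trans_kernel M (ss t) a;
          return (traj_space M (Suc t)) (ss(Suc t := s'), as(t := a)) }"

definition traj_law :: "('s, 'a) cmdp \<Rightarrow> ('s \<Rightarrow> 'a measure) \<Rightarrow> ('s, 'a) traj measure" where
  "traj_law M \<pi> = traj_upto M \<pi> (horizon M)"

definition cum_cost :: "('s, 'a) cmdp \<Rightarrow> nat \<Rightarrow> ('s, 'a) traj \<Rightarrow> real" where
  "cum_cost M t \<tau> = (\<Sum>j<t. cost M (fst \<tau> j) (snd \<tau> j))"

abbreviation traj_cost :: "('s, 'a) cmdp \<Rightarrow> ('s, 'a) traj \<Rightarrow> real" where
  "traj_cost M \<equiv> cum_cost M (horizon M)"

definition test_cost :: "('s, 'a) cmdp \<Rightarrow> (real \<Rightarrow> real) \<Rightarrow> ('s \<Rightarrow> 'a measure) \<Rightarrow> real" where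
  "test_cost M h \<pi> = (\<integral>\<tau>. h (traj_cost M \<tau>) \<partial>traj_law M \<pi>)"


section \<open>The augmented process\<close>

definition aug_space :: "('s, 'a) cmdp \<Rightarrow> ('s \<times> real) measure" where
  "aug_space M = states M \<Otimes>\<^sub>M borel"

definition aug_dist :: "('s, 'a) cmdp \<Rightarrow> ('s \<Rightarrow> 'a measure) \<Rightarrow> nat \<Rightarrow> ('s \<times> real) measure" where
  "aug_dist M \<pi> t = distr (traj_law M \<pi>) (aug_space M) (\<lambda>\<tau>. (fst \<tau> t, cum_cost M t \<tau>))"

definition aug_step :: "('s, 'a) cmdp \<Rightarrow> 's \<times> real \<Rightarrow> 'a \<Rightarrow> ('s \<times> real) measure" where
  "aug_step M x a =
     do { s' \<leftarrow> trans_kernel M (fst x) a;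
          return (aug_space M) (s', snd x + cost M (fst x) a) }"

text \<open>Law of the augmented state \<open>n\<close> steps after it was \<open>x\<close>.\<close>

primrec aug_roll ::
  "('s, 'a) cmdp \<Rightarrow> ('s \<Rightarrow> 'a measure) \<Rightarrow> nat \<Rightarrow> 's \<times> real \<Rightarrow> ('s \<times> real) measure" where
  "aug_roll M \<pi> 0 x = return (aug_space M) x"
| "aug_roll M \<pi> (Suc n) x =
     do { a \<leftarrow> \<pi> (fst x); y \<leftarrow> aug_step M x a; aug_roll M \<pi> n y }"

definition aug_roll_act ::
  "('s, 'a) cmdp \<Rightarrow> ('s \<Rightarrow> 'a measure) \<Rightarrow> nat \<Rightarrow> 's \<times> real \<Rightarrow> 'a \<Rightarrow> ('s \<times> real) measure" where
  "aug_roll_act M \<pi> n x a = do { y \<leftarrow> aug_step M x a; aug_roll M \<pi> n y }"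

text \<open>Conditional expectations given the augmented state at time \<open>t\<close> (and the action) are taken
  in the version provided by the transition kernels, which is defined at every augmented state and
  not only up to null sets.\<close>

definition C_val ::
  "('s, 'a) cmdp \<Rightarrow> (real \<Rightarrow> real) \<Rightarrow> ('s \<Rightarrow> 'a measure) \<Rightarrow> nat \<Rightarrow> 's \<times> real \<Rightarrow> real" where
  "C_val M h \<pi> t x = (\<integral>y. h (snd y) \<partial>aug_roll M \<pi> (horizon M - t) x)"

definition Q_val ::
  "('s, 'a) cmdp \<Rightarrow> (real \<Rightarrow> real) \<Rightarrow> ('s \<Rightarrow> 'a measure) \<Rightarrow> nat \<Rightarrow> 's \<times> real \<Rightarrow> 'a \<Rightarrow> real" where
  "Q_val M h \<pi> t x a = (\<integral>y. h (snd y) \<partial>aug_roll_act M \<pi> (horizon M - Suc t) x a)"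

definition A_val ::
  "('s, 'a) cmdp \<Rightarrow> (real \<Rightarrow> real) \<Rightarrow> ('s \<Rightarrow> 'a measure) \<Rightarrow> nat \<Rightarrow> 's \<times> real \<Rightarrow> 'a \<Rightarrow> real" where
  "A_val M h \<pi> t x a = Q_val M h \<pi> t x a - C_val M h \<pi> t x"

definition exp_adv ::
  "('s, 'a) cmdp \<Rightarrow> (real \<Rightarrow> real) \<Rightarrow> ('s \<Rightarrow> 'a measure) \<Rightarrow> ('s \<Rightarrow> 'a measure) \<Rightarrow>
   nat \<Rightarrow> 's \<times> real \<Rightarrow> real" where
  "exp_adv M h \<pi> \<pi>' t x = (\<integral>a. A_val M h \<pi> t x a \<partial>\<pi>' (fst x))"

text \<open>The maximal expected advantage. It is a supremum in the extended nonnegative reals, hence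
  meaningful also if no maximum exists.\<close>

definition adv_bound ::
  "('s, 'a) cmdp \<Rightarrow> (real \<Rightarrow> real) \<Rightarrow> ('s \<Rightarrow> 'a measure) \<Rightarrow> ('s \<Rightarrow> 'a measure) \<Rightarrow> ennreal" where
  "adv_bound M h \<pi> \<pi>' =
     (SUP t\<in>{..<horizon M}. SUP x\<in>space (aug_space M). ennreal \<bar>exp_adv M h \<pi> \<pi>' t x\<bar>)"

text \<open>The Bochner integral is total with value 0 on non-integrable functions, so well-definedness
  of the expectations of a test function has to be said explicitly.\<close>

definition expectations_defined ::
  "('s, 'a) cmdp \<Rightarrow> (real \<Rightarrow> real) \<Rightarrow> ('s \<Rightarrow> 'a measure) \<Rightarrow> ('s \<Rightarrow> 'a measure) \<Rightarrow> bool" where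
  "expectations_defined M h \<pi> \<pi>' \<longleftrightarrow>
     integrable (traj_law M \<pi>) (\<lambda>\<tau>. h (traj_cost M \<tau>)) \<and>
     integrable (traj_law M \<pi>') (\<lambda>\<tau>. h (traj_cost M \<tau>)) \<and>
     (\<forall>t<horizon M. \<forall>x\<in>space (aug_space M).
        integrable (aug_roll M \<pi> (horizon M - t) x) (\<lambda>y. h (snd y)) \<and>
        (\<forall>a\<in>actions M.
           integrable (aug_roll_act M \<pi> (horizon M - Suc t) x a) (\<lambda>y. h (snd y))) \<and>
        integrable (\<pi>' (fst x)) (A_val M h \<pi> t x)) \<and>
     (\<forall>t<horizon M. integrable (aug_dist M \<pi> t) (exp_adv M h \<pi> \<pi>' t))"


section \<open>Divergences between policies\<close>

definition tv_dist :: "'a set \<Rightarrow> 'a measure \<Rightarrow> 'a measure \<Rightarrow> real" where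
  "tv_dist A p q = (1 / 2) * (\<Sum>\<^sub>\<infinity>a\<in>A. \<bar>measure p {a} - measure q {a}\<bar>)"

definition total_tv ::
  "('s, 'a) cmdp \<Rightarrow> ('s \<Rightarrow> 'a measure) \<Rightarrow> ('s \<Rightarrow> 'a measure) \<Rightarrow> real" where
  "total_tv M \<pi> \<pi>' =
     (\<Sum>t<horizon M. \<integral>x. tv_dist (actions M) (\<pi>' (fst x)) (\<pi> (fst x)) \<partial>aug_dist M \<pi> t)"

text \<open>The divergence of \<open>q\<close> from \<open>p\<close>. The library's \<open>KL_divergence\<close> takes the reference measure first
  and is real-valued; the value \<open>\<infinity>\<close> is added here.\<close>

definition kl_div :: "'a measure \<Rightarrow> 'a measure \<Rightarrow> ennreal" where
  "kl_div q p =
     (if absolutely_continuous p q \<and> integrable q (entropy_density (exp 1) p q)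
      then ennreal (KL_divergence (exp 1) p q) else \<infinity>)"

text \<open>The average over visited states is over the time steps \<open>0, \<dots>, H - 1\<close> and the state
  distributions at these times.\<close>

definition avg_kl ::
  "('s, 'a) cmdp \<Rightarrow> ('s \<Rightarrow> 'a measure) \<Rightarrow> ('s \<Rightarrow> 'a measure) \<Rightarrow> ennreal" where
  "avg_kl M \<pi>' \<pi> =
     (\<Sum>t<horizon M. \<integral>\<^sup>+x. kl_div (\<pi>' (fst x)) (\<pi> (fst x)) \<partial>aug_dist M \<pi> t) /
     of_nat (horizon M)"


section \<open>The Stein discrepancy lower bound\<close>

text \<open>The reference law \<open>a\<^sub>0\<delta>\<^sub>0 + a\<^sub>1\<delta>\<^sub>1 + (1 - a\<^sub>0 - a\<^sub>1) p\<close>, the base kernel and the constants of the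
  estimator. Interior samples are clipped to \<open>[\<eta>, 1 - \<eta>]\<close> with \<open>\<eta> = clip_margin\<close>.\<close>

record stein_setup =
  ref_atom0 :: real
  ref_atom1 :: real
  ref_density :: "real \<Rightarrow> real"
  base_kernel :: "real \<Rightarrow> real \<Rightarrow> real"
  thr0 :: real
  thr1 :: real
  clip_margin :: real
  stein_bound :: real

definition score :: "(real \<Rightarrow> real) \<Rightarrow> real \<Rightarrow> real" where
  "score p x = deriv (\<lambda>v. ln (p v)) x"

definition stein_kernel :: "(real \<Rightarrow> real) \<Rightarrow> (real \<Rightarrow> real \<Rightarrow> real) \<Rightarrow> real \<Rightarrow> real \<Rightarrow> real" where
  "stein_kernel p k x y =
     score p x * k x y * score p y
     + score p x * deriv (\<lambda>v. k x v) y
     + deriv (\<lambda>u. k u y) x * score p y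
     + deriv (\<lambda>u. deriv (\<lambda>v. k u v) y) x"

definition smooth_density :: "(real \<Rightarrow> real) \<Rightarrow> bool" where
  "smooth_density p \<longleftrightarrow>
     (\<forall>x\<in>{0<..<1}. 0 < p x) \<and>
     (p has_integral 1) {0<..<1} \<and>
     (\<forall>n. \<forall>x\<in>{0<..<1}. (deriv ^^ n) p differentiable (at x))"

definition is_base_kernel :: "(real \<Rightarrow> real \<Rightarrow> real) \<Rightarrow> bool" where
  "is_base_kernel k \<longleftrightarrow>
     (\<forall>x\<in>{0<..<1}. \<forall>y\<in>{0<..<1}. k x y = k y x) \<and>
     (\<forall>X f. finite X \<longrightarrow> X \<subseteq> {0<..<1} \<longrightarrow> 0 \<le> (\<Sum>x\<in>X. \<Sum>y\<in>X. f x * f y * k x y)) \<and>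
     (\<forall>x\<in>{0<..<1}. \<forall>y\<in>{0<..<1}.
        (\<lambda>u. k u y) differentiable (at x) \<and>
        (\<lambda>v. k x v) differentiable (at y) \<and>
        (\<lambda>u. deriv (\<lambda>v. k u v) y) differentiable (at x))"

definition is_stein_setup :: "stein_setup \<Rightarrow> bool" where
  "is_stein_setup R \<longleftrightarrow>
     ref_atom0 R \<in> {0..1} \<and> ref_atom1 R \<in> {0..1} \<and>
     smooth_density (ref_density R) \<and>
     is_base_kernel (base_kernel R) \<and>
     0 \<le> thr0 R \<and> 0 \<le> thr1 R \<and> thr0 R < 1 - thr1 R \<and>
     0 < clip_margin R \<and> clip_margin R < 1 / 2 \<and>
     (\<forall>x\<in>{clip_margin R..1 - clip_margin R}. \<forall>y\<in>{clip_margin R..1 - clip_margin R}.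
        \<bar>stein_kernel (ref_density R) (base_kernel R) x y\<bar> \<le> stein_bound R)"

text \<open>In the following, \<open>c 0, \<dots>, c (n - 1)\<close> are the normalized clipped costs of the samples.\<close>

definition emp_atom0 :: "stein_setup \<Rightarrow> nat \<Rightarrow> (nat \<Rightarrow> real) \<Rightarrow> real" where
  "emp_atom0 R n c = real (card {i. i < n \<and> c i \<le> thr0 R}) / real n"

definition emp_atom1 :: "stein_setup \<Rightarrow> nat \<Rightarrow> (nat \<Rightarrow> real) \<Rightarrow> real" where
  "emp_atom1 R n c = real (card {i. i < n \<and> c i \<ge> 1 - thr1 R}) / real n"

definition interior_idx :: "stein_setup \<Rightarrow> nat \<Rightarrow> (nat \<Rightarrow> real) \<Rightarrow> nat set" where
  "interior_idx R n c = {i. i < n \<and> thr0 R < c i \<and> c i < 1 - thr1 R}"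

definition clip :: "stein_setup \<Rightarrow> real \<Rightarrow> real" where
  "clip R x = max (clip_margin R) (min (1 - clip_margin R) x)"

definition SD_int :: "stein_setup \<Rightarrow> nat \<Rightarrow> (nat \<Rightarrow> real) \<Rightarrow> real" where
  "SD_int R n c =
     (\<Sum>i\<in>interior_idx R n c. \<Sum>j\<in>interior_idx R n c.
        stein_kernel (ref_density R) (base_kernel R) (clip R (c i)) (clip R (c j))) /
     (real (card (interior_idx R n c)))\<^sup>2"

definition SD_tot :: "stein_setup \<Rightarrow> nat \<Rightarrow> (nat \<Rightarrow> real) \<Rightarrow> real" where
  "SD_tot R n c =
     max (ref_atom0 R - emp_atom0 R n c) 0
     + max (emp_atom1 R n c - ref_atom1 R) 0
     + (1 - emp_atom0 R n c - emp_atom1 R n c) * SD_int R n c"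

definition eps_w :: "nat \<Rightarrow> real \<Rightarrow> real" where
  "eps_w n \<delta> = 2 * sqrt (ln (6 / \<delta>) / (2 * real n))"

definition eps_int :: "stein_setup \<Rightarrow> nat \<Rightarrow> real \<Rightarrow> real" where
  "eps_int R m \<delta> = 2 * sqrt 2 * stein_bound R * sqrt (ln (6 / \<delta>) / real m)"

text \<open>Without interior samples (\<open>m = 0\<close>) the width \<open>\<epsilon>\<^sub>i\<^sub>n\<^sub>t\<close> is infinite and the lower bound is the
  trivial one, 0; division by zero would give \<open>\<epsilon>\<^sub>i\<^sub>n\<^sub>t = 0\<close> instead.\<close>

definition SD_lower :: "stein_setup \<Rightarrow> nat \<Rightarrow> real \<Rightarrow> (nat \<Rightarrow> real) \<Rightarrow> real" where
  "SD_lower R n \<delta> c =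
     (let m = card (interior_idx R n c) in
      if m = 0 then 0
      else max 0 (SD_tot R n c - eps_int R m \<delta>
                  - eps_w n \<delta> * (1 + SD_int R n c + eps_int R m \<delta>)))"

definition norm_cost :: "('s, 'a) cmdp \<Rightarrow> real \<Rightarrow> ('s, 'a) traj \<Rightarrow> real" where
  "norm_cost M d \<tau> = min (traj_cost M \<tau> / d) 1"

definition SD_rollouts ::
  "('s, 'a) cmdp \<Rightarrow> stein_setup \<Rightarrow> real \<Rightarrow> real \<Rightarrow> nat \<Rightarrow> (nat \<Rightarrow> ('s, 'a) traj) \<Rightarrow> real" where
  "SD_rollouts M R d \<delta> n \<tau>s = SD_lower R n \<delta> (\<lambda>i. norm_cost M d (\<tau>s i))"

definition iid_rollouts ::
  "('s, 'a) cmdp \<Rightarrow> ('s \<Rightarrow> 'a measure) \<Rightarrow> nat \<Rightarrow> 'w measure \<Rightarrow> (nat \<Rightarrow> 'w \<Rightarrow> ('s, 'a) traj) \<Rightarrow> bool"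
where
  "iid_rollouts M \<pi> n \<Omega> \<tau> \<longleftrightarrow>
     prob_space \<Omega> \<and>
     prob_space.indep_vars \<Omega> (\<lambda>i. traj_space M (horizon M)) \<tau> {..<n} \<and>
     (\<forall>i<n. distr \<Omega> (traj_space M (horizon M)) (\<tau> i) = traj_law M \<pi>)"

definition margined_constraint ::
  "('s, 'a) cmdp \<Rightarrow> (real \<Rightarrow> real) \<Rightarrow> ('s \<Rightarrow> 'a measure) \<Rightarrow> ('s \<Rightarrow> 'a measure) \<Rightarrow>
   real \<Rightarrow> real \<Rightarrow> real \<Rightarrow> real \<Rightarrow> bool" where
  "margined_constraint M h \<pi> \<pi>' lam SD \<epsilon> \<delta>\<^sub>K\<^sub>L \<longleftrightarrow>
     test_cost M h \<pi> + (\<Sum>t<horizon M. \<integral>x. exp_adv M h \<pi> \<pi>' t x \<partial>aug_dist M \<pi> t) + lam * SD \<le> \<epsilon> \<and>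
     avg_kl M \<pi>' \<pi> \<le> ennreal \<delta>\<^sub>K\<^sub>L"

text \<open>In the theorem, the new policy \<open>\<pi>'\<close> and the Stein factor \<open>lam\<close> may depend on the sample \<open>\<omega>\<close>
  in an arbitrary way. As no measurability of this dependence is assumed, "with probability at
  least \<open>1 - 2 * \<delta>\<close>" means on a measurable event of at least this probability.\<close>

end

(* The estimate of the risk of the new policy holds surely, so the event can be taken to be the whole
   sample space. By the performance difference identity (telescoping the value functions of the old
   policy along the new one), the risks differ by the sum over t of the expected advantages under the
   state distributions of the new policy. Replacing these by the state distributions of the old policy
   costs at most 2 B times the total variation accumulated up to time t, where B bounds the expected
   advantages; over H steps this is at most 2 H B times the total variation of the policies, which the
   Stein margin absorbs. *)

theory Submission
  imports Defs
begin

text \<open>The test function may be unbounded, so the value functions cannot be estimated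
  uniformly. They enter only through integrals, and since the Bochner integral returns 0 where it is
  undefined, every telescoping step has to carry integrability along. The total variation estimate
  is applied to the expected advantages alone, which are bounded as soon as \<open>adv_bound\<close>
  is finite. Finiteness is read off from the lower bound on the Stein factor, a real number. A
  second obstacle is that the dynamics come in two forms: trajectories grow by a step at the end,
  whereas the rollouts behind the value functions recurse on their initial step. Both are rewritten
  in terms of one kernel, \<open>aug_kernel\<close>, so that they can be combined.\<close>

section \<open>Integration against kernels\<close>

text \<open>Fubini for a kernel and a merely integrable function. Tonelli for \<open>norm f\<close>
  makes the inner integral finite almost everywhere, and the formula follows from Tonelli for the
  positive and the negative part. On the exceptional null set the inner integral has the default
  value 0, which does no harm.\<close>

lemma
  fixes f :: "'b \<Rightarrow> real"
  assumes f[measurable]: "f \<in> borel_measurable B"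
    and N[measurable]: "N \<in> M \<rightarrow>\<^sub>M subprob_algebra B"
    and int: "integrable (M \<bind> N) f"
  shows AE_integrable_bind: "AE x in M. integrable (N x) f"
    and integrable_integral_bind: "integrable M (\<lambda>x. \<integral>y. f y \<partial>N x)"
    and integral_bind_integrable: "(\<integral>y. f y \<partial>(M \<bind> N)) = (\<integral>x. \<integral>y. f y \<partial>N x \<partial>M)"
proof -
  have fN: "f \<in> borel_measurable (N x)" if "x \<in> space M" for x
    using sets_kernel[OF N that] f measurable_cong_sets by blast
  have nn: "(\<integral>\<^sup>+x. \<integral>\<^sup>+y. ennreal (norm (f y)) \<partial>N x \<partial>M) < \<infinity>"
    using int by (subst nn_integral_bind[where B = B, symmetric]) (auto simp: integrable_iff_bounded)
  have "AE x in M. (\<integral>\<^sup>+y. ennreal (norm (f y)) \<partial>N x) \<noteq> \<infinity>"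
    by (rule nn_integral_PInf_AE) (use nn in auto)
  then show ae: "AE x in M. integrable (N x) f"
    using AE_space
    by eventually_elim (auto simp: integrable_iff_bounded fN less_top)
  have le: "AE x in M. ennreal (norm (\<integral>y. f y \<partial>N x)) \<le> (\<integral>\<^sup>+y. ennreal (norm (f y)) \<partial>N x)"
    using ae by eventually_elim (rule integral_norm_bound_ennreal)
  have "(\<integral>\<^sup>+x. ennreal (norm (\<integral>y. f y \<partial>N x)) \<partial>M) < \<infinity>"
    using nn_integral_mono_AE[OF le] nn by (rule le_less_trans)
  then show int': "integrable M (\<lambda>x. \<integral>y. f y \<partial>N x)"
    by (simp add: integrable_iff_bounded)
  \<comment> \<open>Used for \<open>g = f\<close> and \<open>g = - f\<close>: \<open>ennreal\<close>
    cuts negative values off at 0, so these are the positive and the negative part. Domination by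
    \<open>norm f\<close> keeps both integrals finite, hence \<open>enn2real\<close> loses nothing
    outside a null set.\<close>
  have fin: "integrable M (\<lambda>x. enn2real (\<integral>\<^sup>+y. ennreal (g y) \<partial>N x)) \<and>
      enn2real (\<integral>\<^sup>+x. \<integral>\<^sup>+y. ennreal (g y) \<partial>N x \<partial>M) = (\<integral>x. enn2real (\<integral>\<^sup>+y. ennreal (g y) \<partial>N x) \<partial>M)"
    if g[measurable]: "g \<in> borel_measurable B" and gf: "\<And>y. g y \<le> norm (f y)" for g
  proof -
    have "(\<integral>\<^sup>+x. \<integral>\<^sup>+y. ennreal (g y) \<partial>N x \<partial>M) \<le> (\<integral>\<^sup>+x. \<integral>\<^sup>+y. ennreal (norm (f y)) \<partial>N x \<partial>M)"
      using gf by (intro nn_integral_mono ennreal_leI) auto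
    with nn have lt: "(\<integral>\<^sup>+x. \<integral>\<^sup>+y. ennreal (g y) \<partial>N x \<partial>M) < \<infinity>"
      by (rule le_less_trans[rotated])
    then have "AE x in M. (\<integral>\<^sup>+y. ennreal (g y) \<partial>N x) \<noteq> \<infinity>"
      by (intro nn_integral_PInf_AE) auto
    then have e: "AE x in M. ennreal (enn2real (\<integral>\<^sup>+y. ennreal (g y) \<partial>N x)) = (\<integral>\<^sup>+y. ennreal (g y) \<partial>N x)"
      by eventually_elim (auto simp: less_top)
    have eq: "(\<integral>\<^sup>+x. ennreal (enn2real (\<integral>\<^sup>+y. ennreal (g y) \<partial>N x)) \<partial>M) = (\<integral>\<^sup>+x. \<integral>\<^sup>+y. ennreal (g y) \<partial>N x \<partial>M)"
      using e by (rule nn_integral_cong_AE)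
    have "integrable M (\<lambda>x. enn2real (\<integral>\<^sup>+y. ennreal (g y) \<partial>N x))"
      using lt eq by (intro integrableI_nonneg) auto
    moreover have "(\<integral>x. enn2real (\<integral>\<^sup>+y. ennreal (g y) \<partial>N x) \<partial>M) =
        enn2real (\<integral>\<^sup>+x. \<integral>\<^sup>+y. ennreal (g y) \<partial>N x \<partial>M)"
      by (subst integral_eq_nn_integral) (auto simp: eq)
    ultimately show ?thesis by simp
  qed
  have fp: "f y \<le> norm (f y)" and fm: "- f y \<le> norm (f y)" for y by auto
  note p = fin[OF f fp] and m = fin[of "\<lambda>y. - f y", OF _ fm]
  have "(\<integral>y. f y \<partial>(M \<bind> N)) = enn2real (\<integral>\<^sup>+y. ennreal (f y) \<partial>(M \<bind> N)) - enn2real (\<integral>\<^sup>+y. ennreal (- f y) \<partial>(M \<bind> N))"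
    by (rule real_lebesgue_integral_def[OF int])
  also have "\<dots> = (\<integral>x. enn2real (\<integral>\<^sup>+y. ennreal (f y) \<partial>N x) - enn2real (\<integral>\<^sup>+y. ennreal (- f y) \<partial>N x) \<partial>M)"
    using p m by (simp add: nn_integral_bind[where B = B])
  also have "\<dots> = (\<integral>x. \<integral>y. f y \<partial>N x \<partial>M)"
  proof (rule integral_cong_AE)
    show "AE x in M. enn2real (\<integral>\<^sup>+y. ennreal (f y) \<partial>N x) - enn2real (\<integral>\<^sup>+y. ennreal (- f y) \<partial>N x) = (\<integral>y. f y \<partial>N x)"
      using ae by eventually_elim (simp add: real_lebesgue_integral_def)
  qed auto
  finally show "(\<integral>y. f y \<partial>(M \<bind> N)) = (\<integral>x. \<integral>y. f y \<partial>N x \<partial>M)" .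
qed

lemma
  fixes f :: "'b \<Rightarrow> real"
  assumes N: "N \<in> space (prob_algebra X)" and f: "f \<in> borel_measurable X"
    and B: "\<And>y. y \<in> space X \<Longrightarrow> \<bar>f y\<bar> \<le> B"
  shows integrable_prob_algebra: "integrable N f"
    and abs_integral_prob_algebra_le: "\<bar>\<integral>y. f y \<partial>N\<bar> \<le> B"
proof -
  from N have N': "prob_space N" "sets N = sets X" by (auto simp: space_prob_algebra)
  interpret prob_space N by fact
  have ae: "AE y in N. norm (f y) \<le> B" using B sets_eq_imp_space_eq[OF N'(2)] by (intro AE_I2) auto
  show i: "integrable N f"
    by (rule integrable_const_bound[OF ae]) (simp add: measurable_cong_sets[OF N'(2) refl] f)
  have "\<bar>\<integral>y. f y \<partial>N\<bar> \<le> (\<integral>y. \<bar>f y\<bar> \<partial>N)" by (rule integral_abs_bound)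
  also have "\<dots> \<le> (\<integral>y. B \<partial>N)" using i ae by (intro integral_mono_AE) auto
  finally show "\<bar>\<integral>y. f y \<partial>N\<bar> \<le> B" by (simp add: prob_space)
qed

section \<open>Laws on the countable action set and total variation\<close>

text \<open>On a countable set a measure is determined by its point masses. The density form turns
  integrals against action laws into integrals against counting measure, where two policies can be
  compared pointwise.\<close>

lemma prob_countable_eq_density:
  assumes "countable A" and "p \<in> space (prob_algebra (count_space A))"
  shows "p = density (count_space A) (\<lambda>a. ennreal (measure p {a}))"
proof (rule measure_eqI_countable)
  from assms have p: "prob_space p" "sets p = Pow A"
    by (auto simp: space_prob_algebra)
  interpret prob_space p by fact
  show "emeasure p {a} = emeasure (density (count_space A) (\<lambda>a. ennreal (measure p {a}))) {a}" if "a \<in> A" for a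
  proof -
    have "emeasure (density (count_space A) (\<lambda>a. ennreal (measure p {a}))) {a} =
        (\<integral>\<^sup>+x\<in>{a}. ennreal (measure p {x}) \<partial>count_space A)"
      using that by (subst emeasure_density) auto
    also have "\<dots> = (\<integral>\<^sup>+x. ennreal (measure p {a}) * indicator {a} x \<partial>count_space A)"
      by (intro nn_integral_cong) (auto split: split_indicator)
    also have "\<dots> = emeasure p {a}"
      using that by (subst nn_integral_cmult_indicator) (auto simp: emeasure_eq_measure)
    finally show ?thesis by simp
  qed
qed (use assms in \<open>auto simp: space_prob_algebra\<close>)

lemma
  fixes f :: "'a \<Rightarrow> real"
  assumes "countable A" and p: "p \<in> space (prob_algebra (count_space A))"
  shows integrable_prob_countable: "integrable (count_space A) (\<lambda>a. measure p {a})" (is ?int)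
    and integral_prob_countable: "(\<integral>a. measure p {a} \<partial>count_space A) = 1" (is ?one)
    and integral_prob_countable_eq: "(\<integral>a. f a \<partial>p) = (\<integral>a. measure p {a} * f a \<partial>count_space A)"
proof -
  note d = prob_countable_eq_density[OF assms]
  show eq: "(\<integral>a. f a \<partial>p) = (\<integral>a. measure p {a} * f a \<partial>count_space A)" for f :: "'a \<Rightarrow> real"
    by (subst d, subst integral_density) auto
  have iff: "integrable p f \<longleftrightarrow> integrable (count_space A) (\<lambda>a. measure p {a} * f a)" for f :: "'a \<Rightarrow> real"
    by (subst d, subst integrable_density) auto
  interpret prob_space p using p by (simp add: space_prob_algebra)
  show ?int using iff[of "\<lambda>_. 1"] by simp
  show ?one using eq[of "\<lambda>_. 1"] by (simp add: prob_space)
qed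

lemma
  assumes "countable A"
    and p: "p \<in> space (prob_algebra (count_space A))" and q: "q \<in> space (prob_algebra (count_space A))"
  shows tv_dist_eq_integral: "tv_dist A p q = (1 / 2) * (\<integral>a. \<bar>measure p {a} - measure q {a}\<bar> \<partial>count_space A)" (is ?eq)
    and tv_dist_nonneg: "0 \<le> tv_dist A p q"
    and tv_dist_le_1: "tv_dist A p q \<le> 1"
    and integral_diff_le_tv_dist:
      "(\<And>a. a \<in> A \<Longrightarrow> \<bar>f a\<bar> \<le> B) \<Longrightarrow> \<bar>(\<integral>a. f a \<partial>p) - (\<integral>a. f a \<partial>q)\<bar> \<le> 2 * B * tv_dist A p q"
proof -
  note ip = integrable_prob_countable[OF assms(1) p] and iq = integrable_prob_countable[OF assms(1) q]
  have i: "integrable (count_space A) (\<lambda>a. \<bar>measure p {a} - measure q {a}\<bar>)"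
    using ip iq by auto
  \<comment> \<open>The unordered sum in \<open>tv_dist\<close> has the default value 0 if it
    diverges. Absolute summability excludes this and identifies the sum with an integral.\<close>
  show eq: ?eq
    using i infsetsum_infsum[of "\<lambda>a. \<bar>measure p {a} - measure q {a}\<bar>" A]
    unfolding tv_dist_def abs_summable_on_def infsetsum_def by simp
  show "0 \<le> tv_dist A p q" unfolding eq by simp
  have "(\<integral>a. \<bar>measure p {a} - measure q {a}\<bar> \<partial>count_space A) \<le> (\<integral>a. measure p {a} + measure q {a} \<partial>count_space A)"
    using ip iq i by (intro integral_mono) (auto simp: abs_le_iff intro: add_increasing add_increasing2 le_diff_eq)
  also have "\<dots> = 2"
    using ip iq by (simp add: integral_prob_countable[OF assms(1) p] integral_prob_countable[OF assms(1) q])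
  finally show "tv_dist A p q \<le> 1" unfolding eq by simp
  assume B: "\<And>a. a \<in> A \<Longrightarrow> \<bar>f a\<bar> \<le> B"
  have j: "integrable (count_space A) (\<lambda>a. measure r {a} * f a)"
    if "r \<in> space (prob_algebra (count_space A))" for r
    by (rule Bochner_Integration.integrable_bound[OF integrable_mult_left[of B, OF integrable_prob_countable[OF assms(1) that]]])
       (auto simp: abs_mult intro!: mult_left_mono order_trans[OF B])
  have "\<bar>(\<integral>a. f a \<partial>p) - (\<integral>a. f a \<partial>q)\<bar> = \<bar>\<integral>a. measure p {a} * f a - measure q {a} * f a \<partial>count_space A\<bar>"
    by (simp add: integral_prob_countable_eq[OF assms(1) p] integral_prob_countable_eq[OF assms(1) q] j p q)
  also have "\<dots> \<le> (\<integral>a. \<bar>measure p {a} * f a - measure q {a} * f a\<bar> \<partial>count_space A)"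
    by (rule integral_abs_bound)
  also have "\<dots> \<le> (\<integral>a. \<bar>measure p {a} - measure q {a}\<bar> * B \<partial>count_space A)"
  proof (rule integral_mono)
    show "integrable (count_space A) (\<lambda>a. \<bar>measure p {a} * f a - measure q {a} * f a\<bar>)"
      using j[OF p] j[OF q] by auto
    show "\<bar>measure p {a} * f a - measure q {a} * f a\<bar> \<le> \<bar>measure p {a} - measure q {a}\<bar> * B"
      if "a \<in> space (count_space A)" for a
      using that by (auto simp: left_diff_distrib[symmetric] abs_mult intro!: mult_left_mono B)
  qed (use i in auto)
  \<comment> \<open>The constant 2 of all later estimates arises here: the sum of the differences of
    point masses is twice the total variation, because of the factor \<open>1 / 2\<close> in
    \<open>tv_dist\<close>.\<close>
  also have "\<dots> = 2 * B * tv_dist A p q" unfolding eq by simp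
  finally show "\<bar>(\<integral>a. f a \<partial>p) - (\<integral>a. f a \<partial>q)\<bar> \<le> 2 * B * tv_dist A p q" .
qed

section \<open>Measurability of the augmented process\<close>

text \<open>With the action integrated out, the augmented state is a Markov chain with this kernel:
  the policy sees the first component only, and the new cost is added to the second.\<close>

definition aug_kernel :: "('s, 'a) cmdp \<Rightarrow> ('s \<Rightarrow> 'a measure) \<Rightarrow> 's \<times> real \<Rightarrow> ('s \<times> real) measure" where
  "aug_kernel M \<pi> x = do { a \<leftarrow> \<pi> (fst x); aug_step M x a }"

abbreviation aug_state :: "('s, 'a) cmdp \<Rightarrow> nat \<Rightarrow> ('s, 'a) traj \<Rightarrow> 's \<times> real" where
  "aug_state M t \<tau> \<equiv> (fst \<tau> t, cum_cost M t \<tau>)"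

locale cmdp =
  fixes M :: "('s, 'a) cmdp"
  assumes is_cmdp: "is_cmdp M"
begin

lemma countable_actions: "countable (actions M)"
  using is_cmdp by (simp add: is_cmdp_def)

lemma measurable_trans_kernel[measurable (raw)]:
  assumes "f \<in> N \<rightarrow>\<^sub>M states M" and "g \<in> N \<rightarrow>\<^sub>M count_space (actions M)"
  shows "(\<lambda>x. trans_kernel M (f x) (g x)) \<in> N \<rightarrow>\<^sub>M prob_algebra (states M)"
  using measurable_compose[OF measurable_Pair[OF assms], of "case_prod (trans_kernel M)"] is_cmdp
  by (simp add: is_cmdp_def)

lemma measurable_cost[measurable (raw)]:
  assumes "f \<in> N \<rightarrow>\<^sub>M states M" and "g \<in> N \<rightarrow>\<^sub>M count_space (actions M)"
  shows "(\<lambda>x. cost M (f x) (g x)) \<in> borel_measurable N"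
  using measurable_compose[OF measurable_Pair[OF assms], of "case_prod (cost M)"] is_cmdp
  by (simp add: is_cmdp_def)

lemma measurable_fst_aug_space[measurable]: "fst \<in> aug_space M \<rightarrow>\<^sub>M states M"
  and measurable_snd_aug_space[measurable]: "snd \<in> borel_measurable (aug_space M)"
  by (auto simp: aug_space_def)

lemma measurable_Pair_aug_space[measurable (raw)]:
  "f \<in> N \<rightarrow>\<^sub>M states M \<Longrightarrow> g \<in> borel_measurable N \<Longrightarrow> (\<lambda>x. (f x, g x)) \<in> N \<rightarrow>\<^sub>M aug_space M"
  by (auto simp: aug_space_def)

lemma measurable_aug_step[measurable (raw)]:
  assumes [measurable]: "f \<in> N \<rightarrow>\<^sub>M aug_space M" "g \<in> N \<rightarrow>\<^sub>M count_space (actions M)"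
  shows "(\<lambda>x. aug_step M (f x) (g x)) \<in> N \<rightarrow>\<^sub>M prob_algebra (aug_space M)"
  unfolding aug_step_def by measurable

lemma measurable_policy[measurable (raw)]:
  assumes "is_policy M \<pi>" and "f \<in> N \<rightarrow>\<^sub>M states M"
  shows "(\<lambda>x. \<pi> (f x)) \<in> N \<rightarrow>\<^sub>M prob_algebra (count_space (actions M))"
  using measurable_compose[OF assms(2)] assms(1) by (auto simp: is_policy_def)

lemma policy_in_space: "is_policy M \<pi> \<Longrightarrow> s \<in> space (states M) \<Longrightarrow>
    \<pi> s \<in> space (prob_algebra (count_space (actions M)))"
  unfolding is_policy_def by (rule measurable_space)

lemma measurable_component_fst[measurable (raw)]:
  assumes "f \<in> N \<rightarrow>\<^sub>M traj_space M T" "i \<le> T"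
  shows "(\<lambda>x. fst (f x) i) \<in> N \<rightarrow>\<^sub>M states M"
proof -
  have "(\<lambda>x. fst (f x)) \<in> N \<rightarrow>\<^sub>M (\<Pi>\<^sub>M i\<in>{..T}. states M)"
    using assms(1) unfolding traj_space_def by measurable
  then show ?thesis
    by (rule measurable_compose) (use assms(2) in \<open>auto intro: measurable_component_singleton\<close>)
qed

lemma measurable_component_snd[measurable (raw)]:
  assumes "f \<in> N \<rightarrow>\<^sub>M traj_space M T" "i < T"
  shows "(\<lambda>x. snd (f x) i) \<in> N \<rightarrow>\<^sub>M count_space (actions M)"
proof -
  have "(\<lambda>x. snd (f x)) \<in> N \<rightarrow>\<^sub>M (\<Pi>\<^sub>M i\<in>{..<T}. count_space (actions M))"
    using assms(1) unfolding traj_space_def by measurable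
  then show ?thesis
    by (rule measurable_compose) (use assms(2) in \<open>auto intro: measurable_component_singleton\<close>)
qed

lemma measurable_cum_cost[measurable (raw)]:
  assumes "f \<in> N \<rightarrow>\<^sub>M traj_space M T" "t \<le> T"
  shows "(\<lambda>x. cum_cost M t (f x)) \<in> borel_measurable N"
  unfolding cum_cost_def
  by (intro borel_measurable_sum measurable_cost measurable_component_fst[OF assms(1)]
      measurable_component_snd[OF assms(1)]) (use assms(2) in auto)

lemma measurable_extend_traj:
  assumes "f \<in> N \<rightarrow>\<^sub>M traj_space M T" "a \<in> N \<rightarrow>\<^sub>M count_space (actions M)" "s \<in> N \<rightarrow>\<^sub>M states M"
  shows "(\<lambda>x. ((fst (f x))(Suc T := s x), (snd (f x))(T := a x))) \<in> N \<rightarrow>\<^sub>M traj_space M (Suc T)"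
proof -
  have "(\<lambda>x. (fst (f x))(Suc T := s x)) \<in> N \<rightarrow>\<^sub>M (\<Pi>\<^sub>M i\<in>{..Suc T}. states M)"
    by (rule measurable_fun_upd[where J = "{..T}"]) (use assms in \<open>auto simp: traj_space_def\<close>)
  moreover have "(\<lambda>x. (snd (f x))(T := a x)) \<in> N \<rightarrow>\<^sub>M (\<Pi>\<^sub>M i\<in>{..<Suc T}. count_space (actions M))"
    by (rule measurable_fun_upd[where J = "{..<T}"]) (use assms in \<open>auto simp: traj_space_def\<close>)
  ultimately show ?thesis unfolding traj_space_def by (rule measurable_Pair)
qed

context
  fixes \<pi> :: "'s \<Rightarrow> 'a measure"
  assumes policy[measurable]: "is_policy M \<pi>"
begin

lemma measurable_aug_kernel[measurable]: "aug_kernel M \<pi> \<in> aug_space M \<rightarrow>\<^sub>M prob_algebra (aug_space M)"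
  unfolding aug_kernel_def[abs_def] by measurable

text \<open>Associativity of bind. The measurability of \<open>aug_roll M \<pi> n\<close> is a
  hypothesis because the induction that establishes it uses this very equation.\<close>

lemma aug_roll_Suc:
  assumes roll: "aug_roll M \<pi> n \<in> aug_space M \<rightarrow>\<^sub>M prob_algebra (aug_space M)" and x: "x \<in> space (aug_space M)"
  shows "aug_roll M \<pi> (Suc n) x = aug_kernel M \<pi> x \<bind> aug_roll M \<pi> n"
proof -
  have s: "sets (\<pi> (fst x)) = sets (count_space (actions M))"
    using policy_in_space[OF policy, of "fst x"] x measurable_space[OF measurable_fst_aug_space x]
    by (simp add: space_prob_algebra)
  have "aug_step M x \<in> count_space (actions M) \<rightarrow>\<^sub>M prob_algebra (aug_space M)"
    using x by measurable
  then have "aug_step M x \<in> \<pi> (fst x) \<rightarrow>\<^sub>M subprob_algebra (aug_space M)"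
    unfolding measurable_cong_sets[OF s refl] by (rule measurable_prob_algebraD)
  from bind_assoc[OF this measurable_prob_algebraD[OF roll]] show ?thesis
    by (simp add: aug_kernel_def)
qed

lemma measurable_aug_roll[measurable]: "aug_roll M \<pi> n \<in> aug_space M \<rightarrow>\<^sub>M prob_algebra (aug_space M)"
proof (induction n)
  case 0
  show ?case by (simp add: measurable_return_prob_space)
next
  case (Suc n)
  have "(\<lambda>x. aug_kernel M \<pi> x \<bind> aug_roll M \<pi> n) \<in> aug_space M \<rightarrow>\<^sub>M prob_algebra (aug_space M)"
    by (rule measurable_bind_prob_space[OF measurable_aug_kernel Suc])
  then show ?case
    by (subst measurable_cong[OF aug_roll_Suc[OF Suc]])
qed

section \<open>Laws of trajectories\<close>

lemma traj_kernel_measurable: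
  assumes g: "g \<in> traj_space M (Suc T) \<rightarrow>\<^sub>M Y"
  shows "(\<lambda>\<tau>. do { a \<leftarrow> \<pi> (fst \<tau> T); s' \<leftarrow> trans_kernel M (fst \<tau> T) a;
          return Y (g ((fst \<tau>)(Suc T := s'), (snd \<tau>)(T := a))) })
     \<in> traj_space M T \<rightarrow>\<^sub>M prob_algebra Y"
proof -
  have [measurable]: "(\<lambda>x. g ((fst (fst (fst x)))(Suc T := snd x), (snd (fst (fst x)))(T := snd (fst x))))
      \<in> (traj_space M T \<Otimes>\<^sub>M count_space (actions M)) \<Otimes>\<^sub>M states M \<rightarrow>\<^sub>M Y"
    by (rule measurable_compose[OF measurable_extend_traj g]) auto
  show ?thesis by measurable
qed

lemma traj_upto_in_space: "traj_upto M \<pi> T \<in> space (prob_algebra (traj_space M T))"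
proof (induction T)
  case 0
  have i: "init_dist M \<in> space (prob_algebra (states M))"
    using is_cmdp by (simp add: is_cmdp_def)
  have [measurable]: "(\<lambda>s. ((\<lambda>i\<in>{..0}. s), (\<lambda>i\<in>{..<0}. undefined))) \<in> states M \<rightarrow>\<^sub>M traj_space M 0"
    unfolding traj_space_def
    by (intro measurable_Pair measurable_restrict) auto
  have "(\<lambda>s. return (traj_space M 0) ((\<lambda>i\<in>{..0}. s), (\<lambda>i\<in>{..<0}. undefined)))
      \<in> states M \<rightarrow>\<^sub>M prob_algebra (traj_space M 0)"
    by measurable
  \<comment> \<open>The rule for bind speaks of kernels. The single measure
    \<open>init_dist M\<close> is read as a constant kernel on \<open>count_space UNIV\<close> and
    evaluated at the arbitrary point \<open>undefined\<close>.\<close>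
  from measurable_space[OF measurable_bind_prob_space[OF measurable_const[OF i] this], of undefined "count_space UNIV"]
  show ?case by simp
next
  case (Suc T)
  from measurable_space[OF measurable_bind_prob_space[OF measurable_const[OF Suc]
        traj_kernel_measurable[OF measurable_ident, of T]], of undefined "count_space UNIV"]
  show ?case by (simp add: case_prod_unfold)
qed

lemma prob_space_traj_upto: "prob_space (traj_upto M \<pi> T)"
  and sets_traj_upto[measurable_cong]: "sets (traj_upto M \<pi> T) = sets (traj_space M T)"
  using traj_upto_in_space[of T] by (auto simp: space_prob_algebra)

lemma space_traj_upto: "space (traj_upto M \<pi> T) = space (traj_space M T)" "space (traj_upto M \<pi> T) \<noteq> {}"
  using sets_eq_imp_space_eq[OF sets_traj_upto] prob_space.not_empty[OF prob_space_traj_upto] by auto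

text \<open>An image measure is a bind with \<open>return\<close>, and associativity moves this
  \<open>return\<close> through the three nested binds (past, action, next state) to the innermost
  place. There a \<open>g\<close> that ignores part of the last step can be simplified without any
  computation with trajectory measures.\<close>

lemma distr_traj_upto_Suc:
  assumes g[measurable]: "g \<in> traj_space M (Suc T) \<rightarrow>\<^sub>M Y"
  shows "distr (traj_upto M \<pi> (Suc T)) Y g = traj_upto M \<pi> T \<bind>
      (\<lambda>\<tau>. do { a \<leftarrow> \<pi> (fst \<tau> T); s' \<leftarrow> trans_kernel M (fst \<tau> T) a;
          return Y (g ((fst \<tau>)(Suc T := s'), (snd \<tau>)(T := a))) })"
proof -
  let ?K = "\<lambda>\<tau>. do { a \<leftarrow> \<pi> (fst \<tau> T); s' \<leftarrow> trans_kernel M (fst \<tau> T) a;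
          return (traj_space M (Suc T)) ((fst \<tau>)(Suc T := s'), (snd \<tau>)(T := a)) }"
  have K: "?K \<in> traj_space M T \<rightarrow>\<^sub>M prob_algebra (traj_space M (Suc T))"
    using traj_kernel_measurable[OF measurable_ident, of T] by simp
  have "distr (traj_upto M \<pi> (Suc T)) Y g = traj_upto M \<pi> (Suc T) \<bind> (\<lambda>\<tau>. return Y (g \<tau>))"
    by (intro bind_return_distr'[symmetric] space_traj_upto(2))
       (use g in \<open>simp add: measurable_cong_sets[OF sets_traj_upto refl] del: traj_upto.simps\<close>)
  also have "\<dots> = traj_upto M \<pi> T \<bind> (\<lambda>\<tau>. ?K \<tau> \<bind> (\<lambda>\<tau>. return Y (g \<tau>)))"
    unfolding traj_upto.simps case_prod_unfold
    by (rule bind_assoc[where N = "traj_space M (Suc T)" and R = Y])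
       (use K in \<open>auto simp: measurable_cong_sets[OF sets_traj_upto refl] intro: measurable_prob_algebraD\<close>)
  also have "\<dots> = traj_upto M \<pi> T \<bind>
      (\<lambda>\<tau>. do { a \<leftarrow> \<pi> (fst \<tau> T); s' \<leftarrow> trans_kernel M (fst \<tau> T) a;
          return Y (g ((fst \<tau>)(Suc T := s'), (snd \<tau>)(T := a))) })"
  proof (rule bind_cong[OF refl])
    fix \<tau> assume "\<tau> \<in> space (traj_upto M \<pi> T)"
    then have \<tau>: "\<tau> \<in> space (traj_space M T)" by (simp add: space_traj_upto)
    have sT: "fst \<tau> T \<in> space (states M)"
      using \<tau> by (auto simp: traj_space_def space_pair_measure space_PiM PiE_def Pi_def)
    then have s: "sets (\<pi> (fst \<tau> T)) = sets (count_space (actions M))"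
      using policy_in_space[OF policy] by (simp add: space_prob_algebra)
    then have sp: "space (\<pi> (fst \<tau> T)) = actions M" using sets_eq_imp_space_eq[OF s] by simp
    have ext: "(\<lambda>x. ((fst \<tau>)(Suc T := snd x), (snd \<tau>)(T := fst x)))
        \<in> count_space (actions M) \<Otimes>\<^sub>M states M \<rightarrow>\<^sub>M traj_space M (Suc T)"
      using \<tau> by (intro measurable_extend_traj) auto
    have inner: "(\<lambda>a. trans_kernel M (fst \<tau> T) a \<bind> (\<lambda>s'. return (traj_space M (Suc T)) ((fst \<tau>)(Suc T := s'), (snd \<tau>)(T := a))))
        \<in> count_space (actions M) \<rightarrow>\<^sub>M prob_algebra (traj_space M (Suc T))"
      using measurable_compose[OF ext return_measurable]
      by (intro measurable_bind_prob_space2[where N = "states M"] measurable_trans_kernel measurable_const[OF sT])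
         (auto simp: case_prod_unfold intro!: measurable_compose[OF ext] measurable_return_prob_space)
    have "?K \<tau> \<bind> (\<lambda>\<tau>. return Y (g \<tau>)) = \<pi> (fst \<tau> T) \<bind> (\<lambda>a. (trans_kernel M (fst \<tau> T) a \<bind>
        (\<lambda>s'. return (traj_space M (Suc T)) ((fst \<tau>)(Suc T := s'), (snd \<tau>)(T := a)))) \<bind> (\<lambda>\<tau>. return Y (g \<tau>)))"
      by (rule bind_assoc[where N = "traj_space M (Suc T)" and R = Y])
         (use measurable_prob_algebraD[OF inner] in \<open>auto simp: measurable_cong_sets[OF s refl]\<close>)
    also have "\<dots> = \<pi> (fst \<tau> T) \<bind> (\<lambda>a. trans_kernel M (fst \<tau> T) a \<bind>
        (\<lambda>s'. return Y (g ((fst \<tau>)(Suc T := s'), (snd \<tau>)(T := a)))))"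
    proof (rule bind_cong[OF refl])
      fix a assume "a \<in> space (\<pi> (fst \<tau> T))"
      then have a: "a \<in> actions M" using sp by simp
      have "trans_kernel M (fst \<tau> T) a \<in> space (prob_algebra (states M))"
        using measurable_space[OF measurable_trans_kernel[OF measurable_const[OF sT] measurable_ident], of a] a
        by simp
      then have s': "sets (trans_kernel M (fst \<tau> T) a) = sets (states M)" by (simp add: space_prob_algebra)
      have e: "(\<lambda>s'. ((fst \<tau>)(Suc T := s'), (snd \<tau>)(T := a))) \<in> states M \<rightarrow>\<^sub>M traj_space M (Suc T)"
        using \<tau> a by (intro measurable_extend_traj) auto
      have "(trans_kernel M (fst \<tau> T) a \<bind>
        (\<lambda>s'. return (traj_space M (Suc T)) ((fst \<tau>)(Suc T := s'), (snd \<tau>)(T := a)))) \<bind> (\<lambda>\<tau>. return Y (g \<tau>))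
        = trans_kernel M (fst \<tau> T) a \<bind>
        (\<lambda>s'. return (traj_space M (Suc T)) ((fst \<tau>)(Suc T := s'), (snd \<tau>)(T := a)) \<bind> (\<lambda>\<tau>. return Y (g \<tau>)))"
        by (rule bind_assoc[where N = "traj_space M (Suc T)" and R = Y])
           (use e in \<open>auto simp: measurable_cong_sets[OF s' refl]\<close>)
      also have "\<dots> = trans_kernel M (fst \<tau> T) a \<bind> (\<lambda>s'. return Y (g ((fst \<tau>)(Suc T := s'), (snd \<tau>)(T := a))))"
        by (intro bind_cong[OF refl] bind_return[where N = Y])
           (use measurable_space[OF e] sets_eq_imp_space_eq[OF s'] in auto)
      finally show "(trans_kernel M (fst \<tau> T) a \<bind>
        (\<lambda>s'. return (traj_space M (Suc T)) ((fst \<tau>)(Suc T := s'), (snd \<tau>)(T := a)))) \<bind> (\<lambda>\<tau>. return Y (g \<tau>))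
        = trans_kernel M (fst \<tau> T) a \<bind> (\<lambda>s'. return Y (g ((fst \<tau>)(Suc T := s'), (snd \<tau>)(T := a))))" .
    qed
    finally show "?K \<tau> \<bind> (\<lambda>\<tau>. return Y (g \<tau>)) = \<pi> (fst \<tau> T) \<bind> (\<lambda>a. trans_kernel M (fst \<tau> T) a \<bind>
        (\<lambda>s'. return Y (g ((fst \<tau>)(Suc T := s'), (snd \<tau>)(T := a)))))" .
  qed
  finally show ?thesis .
qed

end

end

section \<open>Laws of the augmented state\<close>

context cmdp
begin

lemma measurable_aug_state: "t \<le> T \<Longrightarrow> aug_state M t \<in> traj_space M T \<rightarrow>\<^sub>M aug_space M"
  by (intro measurable_Pair_aug_space measurable_component_fst measurable_cum_cost) auto

lemma measurable_aug_step_act: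
  "x \<in> space (aug_space M) \<Longrightarrow> aug_step M x \<in> count_space (actions M) \<rightarrow>\<^sub>M prob_algebra (aug_space M)"
  using measurable_aug_step[OF measurable_const measurable_ident] by simp

text \<open>The cost up to time \<open>t\<close> reads only states and actions with index below
  \<open>t\<close>. For \<open>t \<le> T\<close> this includes neither the state
  \<open>Suc T\<close> nor the action \<open>T\<close>; for time \<open>Suc T\<close> it includes
  the new action but not the new state.\<close>

lemma cum_cost_extend:
  "t \<le> T \<Longrightarrow> cum_cost M t (ss(Suc T := s), as(T := a)) = cum_cost M t (ss, as)"
  "cum_cost M (Suc T) (ss(Suc T := s), as(T := a)) = cum_cost M T (ss, as) + cost M (ss T) a"
  by (auto simp: cum_cost_def)

context
  fixes \<pi> :: "'s \<Rightarrow> 'a measure"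
  assumes policy: "is_policy M \<pi>"
begin

text \<open>\<open>aug_dist\<close> is read off from trajectories of full length, while induction on
  time needs trajectories that end at \<open>t\<close>. The steps after \<open>t\<close> do not
  change the augmented state at time \<open>t\<close>, and as probability kernels they integrate to
  1.\<close>

lemma distr_aug_state:
  assumes "t \<le> T"
  shows "distr (traj_upto M \<pi> T) (aug_space M) (aug_state M t) =
    distr (traj_upto M \<pi> t) (aug_space M) (aug_state M t)"
  using assms
proof (induction T rule: dec_induct)
  case (step T)
  have "distr (traj_upto M \<pi> (Suc T)) (aug_space M) (aug_state M t) =
      traj_upto M \<pi> T \<bind> (\<lambda>\<tau>. do { a \<leftarrow> \<pi> (fst \<tau> T); s' \<leftarrow> trans_kernel M (fst \<tau> T) a;
          return (aug_space M) (aug_state M t ((fst \<tau>)(Suc T := s'), (snd \<tau>)(T := a))) })"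
    using step.hyps by (intro distr_traj_upto_Suc[OF policy] measurable_aug_state) auto
  also have "\<dots> = traj_upto M \<pi> T \<bind> (\<lambda>\<tau>. return (aug_space M) (aug_state M t \<tau>))"
  proof (rule bind_cong[OF refl])
    fix \<tau> assume "\<tau> \<in> space (traj_upto M \<pi> T)"
    then have \<tau>: "\<tau> \<in> space (traj_space M T)" by (simp add: space_traj_upto[OF policy])
    have sT: "fst \<tau> T \<in> space (states M)"
      using measurable_space[OF measurable_component_fst[OF measurable_ident, of T T] \<tau>] by simp
    let ?x = "aug_state M t \<tau>"
    have x: "?x \<in> space (aug_space M)"
      using measurable_space[OF measurable_aug_state \<tau>] step.hyps by simp
    have \<pi>: "\<pi> (fst \<tau> T) \<in> space (prob_algebra (count_space (actions M)))"
      by (rule policy_in_space[OF policy sT])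
    have "do { a \<leftarrow> \<pi> (fst \<tau> T); s' \<leftarrow> trans_kernel M (fst \<tau> T) a;
          return (aug_space M) (aug_state M t ((fst \<tau>)(Suc T := s'), (snd \<tau>)(T := a))) }
      = do { a \<leftarrow> \<pi> (fst \<tau> T); s' \<leftarrow> trans_kernel M (fst \<tau> T) a; return (aug_space M) ?x }"
      using step.hyps by (simp add: cum_cost_extend)
    also have "\<dots> = do { a \<leftarrow> \<pi> (fst \<tau> T); return (aug_space M) ?x }"
    proof (intro bind_cong[OF refl] bind_const')
      fix a assume "a \<in> space (\<pi> (fst \<tau> T))"
      then have "a \<in> space (count_space (actions M))"
        using \<pi> sets_eq_imp_space_eq unfolding space_prob_algebra by blast
      from measurable_space[OF measurable_trans_kernel[OF measurable_const[OF sT] measurable_ident] this]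
      show "prob_space (trans_kernel M (fst \<tau> T) a)"
        by (simp add: space_prob_algebra)
    qed (use x in \<open>auto intro: prob_space_return prob_space_imp_subprob_space\<close>)
    also have "\<dots> = return (aug_space M) ?x"
      using \<pi> x by (intro bind_const') (auto simp: space_prob_algebra intro: prob_space_return prob_space_imp_subprob_space)
    finally show "do { a \<leftarrow> \<pi> (fst \<tau> T); s' \<leftarrow> trans_kernel M (fst \<tau> T) a;
          return (aug_space M) (aug_state M t ((fst \<tau>)(Suc T := s'), (snd \<tau>)(T := a))) } = return (aug_space M) ?x" .
  qed
  also have "\<dots> = distr (traj_upto M \<pi> T) (aug_space M) (aug_state M t)"
    using measurable_aug_state[of t T] step.hyps
    by (intro bind_return_distr' space_traj_upto(2)[OF policy])
       (simp add: measurable_cong_sets[OF sets_traj_upto[OF policy] refl])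
  finally show ?case using step.IH by simp
qed simp

lemma aug_dist_eq: "t \<le> horizon M \<Longrightarrow> aug_dist M \<pi> t = distr (traj_upto M \<pi> t) (aug_space M) (aug_state M t)"
  unfolding aug_dist_def traj_law_def by (rule distr_aug_state)

lemma aug_dist_in_space:
  assumes "t \<le> horizon M"
  shows "aug_dist M \<pi> t \<in> space (prob_algebra (aug_space M))"
proof -
  interpret prob_space "traj_upto M \<pi> t" by (rule prob_space_traj_upto[OF policy])
  show ?thesis
    unfolding aug_dist_eq[OF assms] using measurable_aug_state[of t t]
    by (auto simp: space_prob_algebra measurable_cong_sets[OF sets_traj_upto[OF policy] refl] intro!: prob_space_distr)
qed

lemma
  assumes "t \<le> horizon M"
  shows prob_space_aug_dist: "prob_space (aug_dist M \<pi> t)"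
    and sets_aug_dist: "sets (aug_dist M \<pi> t) = sets (aug_space M)"
    and space_aug_dist: "space (aug_dist M \<pi> t) = space (aug_space M)"
  using aug_dist_in_space[OF assms] sets_eq_imp_space_eq by (auto simp: space_prob_algebra)

lemma measurable_aug_dist: "t \<le> horizon M \<Longrightarrow> measurable (aug_dist M \<pi> t) N = measurable (aug_space M) N"
  by (rule measurable_cong_sets[OF sets_aug_dist refl])

text \<open>In the truncated trajectory the step from \<open>t\<close> to \<open>Suc t\<close> is
  the last one and can be split off. The remaining integrand depends on the trajectory only through
  its augmented state at time \<open>t\<close>, so the law of that state can replace the trajectory
  law.\<close>

lemma aug_dist_Suc:
  assumes "t < horizon M"
  shows "aug_dist M \<pi> (Suc t) = aug_dist M \<pi> t \<bind> aug_kernel M \<pi>"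
proof -
  have "aug_dist M \<pi> (Suc t) = traj_upto M \<pi> t \<bind> (\<lambda>\<tau>. do { a \<leftarrow> \<pi> (fst \<tau> t); s' \<leftarrow> trans_kernel M (fst \<tau> t) a;
          return (aug_space M) (aug_state M (Suc t) ((fst \<tau>)(Suc t := s'), (snd \<tau>)(t := a))) })"
    unfolding aug_dist_eq[OF Suc_leI[OF assms]]
    by (rule distr_traj_upto_Suc[OF policy measurable_aug_state[OF le_refl]])
  also have "\<dots> = traj_upto M \<pi> t \<bind> (\<lambda>\<tau>. aug_kernel M \<pi> (aug_state M t \<tau>))"
    by (simp add: aug_kernel_def aug_step_def cum_cost_extend)
  also have "\<dots> = aug_dist M \<pi> t \<bind> aug_kernel M \<pi>"
    using assms measurable_aug_state[of t t] measurable_prob_algebraD[OF measurable_aug_kernel[OF policy]]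
    by (subst aug_dist_eq)
       (auto simp: measurable_cong_sets[OF sets_traj_upto[OF policy] refl]
         intro!: bind_distr[symmetric] space_traj_upto(2)[OF policy])
  finally show ?thesis .
qed

text \<open>Chapman-Kolmogorov. The initial step of the roll is absorbed into the law, which
  advances \<open>t\<close>; hence \<open>t\<close> is arbitrary in the induction on
  \<open>n\<close>. This links the trajectory law to the value functions.\<close>

lemma aug_dist_bind_aug_roll:
  "t + n \<le> horizon M \<Longrightarrow> aug_dist M \<pi> t \<bind> aug_roll M \<pi> n = aug_dist M \<pi> (t + n)"
proof (induction n arbitrary: t)
  case 0
  then show ?case
    using sets_aug_dist[of t] bind_return''[of "aug_dist M \<pi> t" "aug_space M"]
    by (simp add: aug_roll.simps(1)[abs_def])
next
  case (Suc n)
  note roll = measurable_aug_roll[OF policy, of n]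
  have "aug_dist M \<pi> t \<bind> aug_roll M \<pi> (Suc n) =
      aug_dist M \<pi> t \<bind> (\<lambda>x. aug_kernel M \<pi> x \<bind> aug_roll M \<pi> n)"
    by (intro bind_cong[OF refl] aug_roll_Suc[OF policy roll]) (use Suc.prems in \<open>simp add: space_aug_dist\<close>)
  also have "\<dots> = (aug_dist M \<pi> t \<bind> aug_kernel M \<pi>) \<bind> aug_roll M \<pi> n"
    using measurable_prob_algebraD[OF roll] measurable_prob_algebraD[OF measurable_aug_kernel[OF policy]] Suc.prems
    by (intro bind_assoc[symmetric]) (auto simp: measurable_aug_dist)
  also have "\<dots> = aug_dist M \<pi> (t + Suc n)"
    using Suc by (simp add: aug_dist_Suc[symmetric])
  finally show ?case .
qed

lemma integral_aug_kernel:
  fixes f :: "'s \<times> real \<Rightarrow> real"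
  assumes f: "f \<in> borel_measurable (aug_space M)" and x: "x \<in> space (aug_space M)"
    and "integrable (aug_kernel M \<pi> x) f"
  shows "(\<integral>y. f y \<partial>aug_kernel M \<pi> x) = (\<integral>a. \<integral>y. f y \<partial>aug_step M x a \<partial>\<pi> (fst x))"
proof -
  have s: "sets (\<pi> (fst x)) = sets (count_space (actions M))"
    using policy_in_space[OF policy] measurable_space[OF measurable_fst_aug_space x]
    by (simp add: space_prob_algebra)
  show ?thesis
    using assms(3) unfolding aug_kernel_def
    by (intro integral_bind_integrable[OF f])
       (simp_all only: measurable_cong_sets[OF s refl] measurable_prob_algebraD[OF measurable_aug_step_act[OF x]])
qed

section \<open>Value functions\<close>

context
  fixes h :: "real \<Rightarrow> real"
  assumes h[measurable]: "h \<in> borel_measurable borel"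
begin

lemma measurable_h_snd: "(\<lambda>y. h (snd y)) \<in> borel_measurable (aug_space M)"
  by measurable

lemma measurable_C_val: "C_val M h \<pi> t \<in> borel_measurable (aug_space M)"
  unfolding C_val_def[abs_def]
  by (rule measurable_compose[OF measurable_prob_algebraD[OF measurable_aug_roll[OF policy]]
        integral_measurable_subprob_algebra[OF measurable_h_snd]])

lemma C_val_horizon: "x \<in> space (aug_space M) \<Longrightarrow> C_val M h \<pi> (horizon M) x = h (snd x)"
  unfolding C_val_def by (simp add: integral_return[OF _ measurable_h_snd])

lemma measurable_aug_state_horizon: "aug_state M (horizon M) \<in> traj_law M \<pi> \<rightarrow>\<^sub>M aug_space M"
  unfolding traj_law_def measurable_cong_sets[OF sets_traj_upto[OF policy] refl]
  by (rule measurable_aug_state) simp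

lemma test_cost_eq: "test_cost M h \<pi> = (\<integral>y. h (snd y) \<partial>aug_dist M \<pi> (horizon M))"
  unfolding test_cost_def aug_dist_def
  by (subst integral_distr[OF measurable_aug_state_horizon measurable_h_snd]) simp

lemma integrable_aug_dist_horizon:
  "integrable (traj_law M \<pi>) (\<lambda>\<tau>. h (traj_cost M \<tau>)) \<longleftrightarrow>
    integrable (aug_dist M \<pi> (horizon M)) (\<lambda>y. h (snd y))"
  unfolding aug_dist_def
  by (subst integrable_distr_eq[OF measurable_aug_state_horizon measurable_h_snd]) simp

lemma test_cost_eq_C_val:
  assumes "integrable (traj_law M \<pi>) (\<lambda>\<tau>. h (traj_cost M \<tau>))"
  shows "test_cost M h \<pi> = (\<integral>x. C_val M h \<pi> 0 x \<partial>aug_dist M \<pi> 0)"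
proof -
  have e: "aug_dist M \<pi> (horizon M) = aug_dist M \<pi> 0 \<bind> aug_roll M \<pi> (horizon M)"
    using aug_dist_bind_aug_roll[of 0 "horizon M"] by simp
  have "(\<integral>y. h (snd y) \<partial>(aug_dist M \<pi> 0 \<bind> aug_roll M \<pi> (horizon M))) =
      (\<integral>x. \<integral>y. h (snd y) \<partial>aug_roll M \<pi> (horizon M) x \<partial>aug_dist M \<pi> 0)"
    using assms unfolding integrable_aug_dist_horizon e
    by (intro integral_bind_integrable[OF measurable_h_snd])
       (simp_all add: measurable_aug_dist measurable_prob_algebraD[OF measurable_aug_roll[OF policy]])
  then show ?thesis
    unfolding test_cost_eq e C_val_def by simp
qed

text \<open>\<open>Q_val\<close> at \<open>t\<close> and \<open>C_val\<close> at
  \<open>Suc t\<close> both roll for \<open>horizon M - Suc t\<close> steps, so Fubini is needed for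
  a single step only.\<close>

lemma Q_val_eq:
  assumes "x \<in> space (aug_space M)" "a \<in> actions M"
    and int: "integrable (aug_roll_act M \<pi> (horizon M - Suc t) x a) (\<lambda>y. h (snd y))"
  shows "Q_val M h \<pi> t x a = (\<integral>y. C_val M h \<pi> (Suc t) y \<partial>aug_step M x a)"
proof -
  have s: "sets (aug_step M x a) = sets (aug_space M)"
    using measurable_space[OF measurable_aug_step_act[OF assms(1)], of a] assms(2) by (simp add: space_prob_algebra)
  show ?thesis
    using int unfolding Q_val_def C_val_def aug_roll_act_def
    by (intro integral_bind_integrable[OF measurable_h_snd])
       (auto simp: measurable_cong_sets[OF s refl] measurable_prob_algebraD[OF measurable_aug_roll[OF policy]])
qed

end

end

section \<open>The performance difference identity\<close>

context
  fixes \<pi> \<pi>' :: "'s \<Rightarrow> 'a measure"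
  assumes policies: "is_policy M \<pi>" "is_policy M \<pi>'"
begin

lemma aug_dist_0: "aug_dist M \<pi>' 0 = aug_dist M \<pi> 0"
  using policies by (simp add: aug_dist_eq)

lemma space_policy:
  assumes "x \<in> space (aug_space M)"
  shows "space (\<pi>' (fst x)) = actions M" "prob_space (\<pi>' (fst x))"
  using policy_in_space[OF policies(2) measurable_space[OF measurable_fst_aug_space assms]]
    sets_eq_imp_space_eq[of "\<pi>' (fst x)" "count_space (actions M)"]
  by (auto simp: space_prob_algebra)

text \<open>The identity that telescopes. \<open>Q_val\<close> is the average old value one step
  later, and averaging over the action of \<open>\<pi>'\<close> turns this step into one of
  \<open>aug_kernel M \<pi>'\<close>.\<close>

lemma exp_adv_eq:
  assumes h: "h \<in> borel_measurable borel" and ex: "expectations_defined M h \<pi> \<pi>'"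
    and t: "t < horizon M" and x: "x \<in> space (aug_space M)"
    and int: "integrable (aug_kernel M \<pi>' x) (C_val M h \<pi> (Suc t))"
  shows "exp_adv M h \<pi> \<pi>' t x = (\<integral>y. C_val M h \<pi> (Suc t) y \<partial>aug_kernel M \<pi>' x) - C_val M h \<pi> t x"
proof -
  interpret prob_space "\<pi>' (fst x)" using space_policy[OF x] by simp
  have A: "integrable (\<pi>' (fst x)) (A_val M h \<pi> t x)"
    and roll: "\<And>a. a \<in> actions M \<Longrightarrow> integrable (aug_roll_act M \<pi> (horizon M - Suc t) x a) (\<lambda>y. h (snd y))"
    using ex t x by (auto simp: expectations_defined_def)
  \<comment> \<open>Integrability in the action is given for \<open>A_val\<close>. The constant
    \<open>C_val M h \<pi> t x\<close> goes inside the integral unchanged, as the action law has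
    mass 1, and the integrand becomes \<open>Q_val\<close>.\<close>
  have "exp_adv M h \<pi> \<pi>' t x = (\<integral>a. A_val M h \<pi> t x a + C_val M h \<pi> t x \<partial>\<pi>' (fst x)) - C_val M h \<pi> t x"
    using A by (simp add: exp_adv_def prob_space)
  also have "(\<integral>a. A_val M h \<pi> t x a + C_val M h \<pi> t x \<partial>\<pi>' (fst x)) =
      (\<integral>a. \<integral>y. C_val M h \<pi> (Suc t) y \<partial>aug_step M x a \<partial>\<pi>' (fst x))"
    using roll x space_policy[OF x]
    by (intro Bochner_Integration.integral_cong) (auto simp: A_val_def Q_val_eq[OF policies(1) h])
  also have "\<dots> = (\<integral>y. C_val M h \<pi> (Suc t) y \<partial>aug_kernel M \<pi>' x)"
    using integral_aug_kernel[OF policies(2) measurable_C_val[OF policies(1) h] x int] by simp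
  finally show ?thesis .
qed

text \<open>The induction runs backwards because integrability of the old value functions under the
  laws of \<open>\<pi>'\<close> is known at the horizon only, where the value is \<open>h\<close> of
  the accumulated cost. Each step passes it from \<open>Suc t\<close> to \<open>t\<close>, which is
  why it is part of the claim.\<close>

lemma performance_difference_aux:
  assumes h: "h \<in> borel_measurable borel" and ex: "expectations_defined M h \<pi> \<pi>'"
    and adv: "\<And>t. t < horizon M \<Longrightarrow> integrable (aug_dist M \<pi>' t) (exp_adv M h \<pi> \<pi>' t)"
    and "t \<le> horizon M"
  shows "integrable (aug_dist M \<pi>' t) (C_val M h \<pi> t) \<and>
    test_cost M h \<pi>' = (\<integral>x. C_val M h \<pi> t x \<partial>aug_dist M \<pi>' t) +
      (\<Sum>j=t..<horizon M. \<integral>x. exp_adv M h \<pi> \<pi>' j x \<partial>aug_dist M \<pi>' j)"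
  using \<open>t \<le> horizon M\<close>
proof (induction t rule: inc_induct)
  case base
  have "integrable (aug_dist M \<pi>' (horizon M)) (\<lambda>y. h (snd y))"
    using ex integrable_aug_dist_horizon[OF policies(2) h] by (auto simp: expectations_defined_def)
  moreover have "integrable (aug_dist M \<pi>' (horizon M)) (C_val M h \<pi> (horizon M)) \<longleftrightarrow>
      integrable (aug_dist M \<pi>' (horizon M)) (\<lambda>y. h (snd y))"
    using policies h by (intro Bochner_Integration.integrable_cong) (auto simp: space_aug_dist C_val_horizon)
  moreover have "(\<integral>x. C_val M h \<pi> (horizon M) x \<partial>aug_dist M \<pi>' (horizon M)) = test_cost M h \<pi>'"
    unfolding test_cost_eq[OF policies(2) h]
    using policies h by (intro Bochner_Integration.integral_cong) (auto simp: space_aug_dist C_val_horizon)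
  ultimately show ?case by simp
next
  case (step t)
  let ?V = "C_val M h \<pi>" and ?D = "aug_dist M \<pi>' t" and ?K = "aug_kernel M \<pi>'"
  note V = measurable_C_val[OF policies(1) h]
  have t: "t \<le> horizon M" using step.hyps by simp
  have K: "?K \<in> ?D \<rightarrow>\<^sub>M subprob_algebra (aug_space M)"
    using measurable_prob_algebraD[OF measurable_aug_kernel[OF policies(2)]]
    by (simp add: measurable_aug_dist[OF policies(2) t])
  have D: "aug_dist M \<pi>' (Suc t) = ?D \<bind> ?K"
    by (rule aug_dist_Suc[OF policies(2) step.hyps(2)])
  note IH = step.IH[unfolded D]
  note KV = AE_integrable_bind[OF V K] integrable_integral_bind[OF V K] integral_bind_integrable[OF V K]
  have i1: "integrable ?D (\<lambda>x. \<integral>y. ?V (Suc t) y \<partial>?K x)"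
    using KV(2) IH by blast
  note i2 = adv[OF step.hyps(2)]
  \<comment> \<open>Integrability of the next value under the kernel at \<open>x\<close> follows
    from the induction hypothesis only for almost every \<open>x\<close>, so the identity holds
    almost everywhere.\<close>
  have ae: "AE x in ?D. ?V t x = (\<integral>y. ?V (Suc t) y \<partial>?K x) - exp_adv M h \<pi> \<pi>' t x"
    using KV(1)[OF conjunct1[OF IH]] AE_space
    by eventually_elim
       (use exp_adv_eq[OF h ex step.hyps(2)] in \<open>simp add: space_aug_dist[OF policies(2) t]\<close>)
  have VD: "?V t \<in> borel_measurable ?D"
    using V by (simp add: measurable_aug_dist[OF policies(2) t])
  have md: "(\<lambda>x. (\<integral>y. ?V (Suc t) y \<partial>?K x) - exp_adv M h \<pi> \<pi>' t x) \<in> borel_measurable ?D"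
    using i1 i2 by auto
  have i: "integrable ?D (?V t)"
    using i1 i2 by (subst integrable_cong_AE[OF VD md ae]) auto
  have "(\<integral>x. ?V t x \<partial>?D) = (\<integral>x. (\<integral>y. ?V (Suc t) y \<partial>?K x) - exp_adv M h \<pi> \<pi>' t x \<partial>?D)"
    by (rule integral_cong_AE[OF VD md ae])
  also have "\<dots> = (\<integral>y. ?V (Suc t) y \<partial>(?D \<bind> ?K)) - (\<integral>x. exp_adv M h \<pi> \<pi>' t x \<partial>?D)"
    using i1 i2 KV(3)[OF conjunct1[OF IH]] by simp
  finally show ?case
    using i IH step.hyps by (simp add: sum.atLeast_Suc_lessThan)
qed

text \<open>\<open>expectations_defined\<close> yields integrability of the expected advantages
  under the state laws of \<open>\<pi>\<close>. Under those of \<open>\<pi>'\<close> it is the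
  separate hypothesis \<open>adv\<close>, to be supplied by equality of the laws or by
  boundedness.\<close>

theorem performance_difference:
  assumes h: "h \<in> borel_measurable borel" and ex: "expectations_defined M h \<pi> \<pi>'"
    and adv: "\<And>t. t < horizon M \<Longrightarrow> integrable (aug_dist M \<pi>' t) (exp_adv M h \<pi> \<pi>' t)"
  shows "test_cost M h \<pi>' = test_cost M h \<pi> + (\<Sum>t<horizon M. \<integral>x. exp_adv M h \<pi> \<pi>' t x \<partial>aug_dist M \<pi>' t)"
proof -
  have "integrable (traj_law M \<pi>) (\<lambda>\<tau>. h (traj_cost M \<tau>))"
    using ex by (simp add: expectations_defined_def)
  then show ?thesis
    using performance_difference_aux[OF assms, of 0] test_cost_eq_C_val[OF policies(1) h]
    by (simp add: aug_dist_0 atLeast0LessThan)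
qed

section \<open>Distance between the state laws of the two policies\<close>

abbreviation "tv_at x \<equiv> tv_dist (actions M) (\<pi>' (fst x)) (\<pi> (fst x))"

text \<open>From a fixed \<open>x\<close> the two kernels differ in the action law alone. The
  average of \<open>f\<close> over the next state is a function of the action bounded by
  \<open>B\<close>, so the estimate for discrete laws applies.\<close>

lemma
  assumes x: "x \<in> space (aug_space M)"
  shows tv_at_nonneg: "0 \<le> tv_at x" and tv_at_le_1: "tv_at x \<le> 1"
    and aug_kernel_diff: "\<And>f B. f \<in> borel_measurable (aug_space M) \<Longrightarrow>
      (\<And>y. y \<in> space (aug_space M) \<Longrightarrow> \<bar>f y\<bar> \<le> B) \<Longrightarrow>
      \<bar>(\<integral>y. f y \<partial>aug_kernel M \<pi>' x) - (\<integral>y. f y \<partial>aug_kernel M \<pi> x)\<bar> \<le> 2 * B * tv_at x"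
proof -
  have fx: "fst x \<in> space (states M)" using measurable_space[OF measurable_fst_aug_space x] .
  note p = countable_actions policy_in_space[OF policies(2) fx] policy_in_space[OF policies(1) fx]
  show "0 \<le> tv_at x" "tv_at x \<le> 1"
    using tv_dist_nonneg[OF p] tv_dist_le_1[OF p] by auto
  fix f :: "'s \<times> real \<Rightarrow> real" and B
  assume f: "f \<in> borel_measurable (aug_space M)" and B: "\<And>y. y \<in> space (aug_space M) \<Longrightarrow> \<bar>f y\<bar> \<le> B"
  have bounded: "integrable N f \<and> \<bar>\<integral>y. f y \<partial>N\<bar> \<le> B" if "N \<in> space (prob_algebra (aug_space M))" for N
    using integrable_prob_algebra[OF that f B] abs_integral_prob_algebra_le[OF that f B] by simp
  have K: "(\<integral>y. f y \<partial>aug_kernel M \<rho> x) = (\<integral>a. \<integral>y. f y \<partial>aug_step M x a \<partial>\<rho> (fst x))" if "is_policy M \<rho>" for \<rho>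
    using bounded[OF measurable_space[OF measurable_aug_kernel[OF that] x]]
    by (intro integral_aug_kernel[OF that f x]) auto
  show "\<bar>(\<integral>y. f y \<partial>aug_kernel M \<pi>' x) - (\<integral>y. f y \<partial>aug_kernel M \<pi> x)\<bar> \<le> 2 * B * tv_at x"
    unfolding K[OF policies(1)] K[OF policies(2)]
    by (rule integral_diff_le_tv_dist[OF p])
       (use bounded[OF measurable_space[OF measurable_aug_step_act[OF x]]] in auto)
qed

text \<open>Countability of the actions reduces joint measurability to one action at a time and
  makes the counting measure sigma-finite, as needed for the parameter integral.\<close>

lemma measurable_tv_at: "tv_at \<in> borel_measurable (aug_space M)"
proof -
  interpret sigma_finite_measure "count_space (actions M)"
    by (rule sigma_finite_measure_count_space_countable[OF countable_actions])
  have m: "(\<lambda>x. measure (\<rho> (fst x)) {a}) \<in> borel_measurable (aug_space M)" if "is_policy M \<rho>" "a \<in> actions M" for \<rho> a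
    by (rule measurable_compose[OF measurable_prob_algebraD[OF measurable_policy[OF that(1) measurable_fst_aug_space]]
          measurable_measure_subprob_algebra]) (use that in auto)
  have "(\<lambda>(x, a). \<bar>measure (\<pi>' (fst x)) {a} - measure (\<pi> (fst x)) {a}\<bar>)
      \<in> borel_measurable (aug_space M \<Otimes>\<^sub>M count_space (actions M))"
    unfolding case_prod_beta'
    by (rule measurable_compose_countable'[OF _ measurable_snd countable_actions])
       (use m policies in \<open>auto intro!: borel_measurable_abs borel_measurable_diff measurable_compose[OF measurable_fst]\<close>)
  from borel_measurable_lebesgue_integral[OF this]
  have "(\<lambda>x. (1 / 2) * (\<integral>a. \<bar>measure (\<pi>' (fst x)) {a} - measure (\<pi> (fst x)) {a}\<bar> \<partial>count_space (actions M)))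
      \<in> borel_measurable (aug_space M)"
    by simp
  then show ?thesis
  proof (subst measurable_cong)
    fix x assume "x \<in> space (aug_space M)"
    then have fx: "fst x \<in> space (states M)" using measurable_space[OF measurable_fst_aug_space] by blast
    show "tv_at x = (1 / 2) * (\<integral>a. \<bar>measure (\<pi>' (fst x)) {a} - measure (\<pi> (fst x)) {a}\<bar> \<partial>count_space (actions M))"
      by (rule tv_dist_eq_integral[OF countable_actions policy_in_space[OF policies(2) fx] policy_in_space[OF policies(1) fx]])
  qed
qed

lemma
  assumes "t \<le> horizon M"
  shows integrable_tv_at: "integrable (aug_dist M \<pi> t) tv_at"
    and integral_tv_at_nonneg: "0 \<le> (\<integral>x. tv_at x \<partial>aug_dist M \<pi> t)"
proof -
  interpret prob_space "aug_dist M \<pi> t" by (rule prob_space_aug_dist[OF policies(1) assms])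
  show "integrable (aug_dist M \<pi> t) tv_at"
    by (rule integrable_const_bound[where B = 1])
       (use assms tv_at_nonneg tv_at_le_1 measurable_tv_at in
         \<open>auto intro!: AE_I2 simp: space_aug_dist[OF policies(1)] measurable_aug_dist[OF policies(1)]\<close>)
  show "0 \<le> (\<integral>x. tv_at x \<partial>aug_dist M \<pi> t)"
    using assms tv_at_nonneg by (intro integral_nonneg_AE AE_I2) (auto simp: space_aug_dist[OF policies(1)])
qed

text \<open>Hybrid argument: from the new law with a new step, pass to the old law with a new step,
  then to the old law with an old step. In this order the one-step error is averaged over the old
  law, where the total variation is measured. Averaging over a kernel preserves the bound
  \<open>B\<close>, so the induction is over all \<open>f\<close> with the same
  \<open>B\<close>.\<close>

lemma aug_dist_diff:
  assumes "t \<le> horizon M" "f \<in> borel_measurable (aug_space M)"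
    and "\<And>x. x \<in> space (aug_space M) \<Longrightarrow> \<bar>f x\<bar> \<le> B"
  shows "\<bar>(\<integral>x. f x \<partial>aug_dist M \<pi>' t) - (\<integral>x. f x \<partial>aug_dist M \<pi> t)\<bar>
    \<le> 2 * B * (\<Sum>j<t. \<integral>x. tv_at x \<partial>aug_dist M \<pi> j)"
  using assms
proof (induction t arbitrary: f)
  case 0
  then show ?case by (simp add: aug_dist_0)
next
  case (Suc t)
  have t: "t \<le> horizon M" "t < horizon M" using Suc.prems by auto
  note f = Suc.prems(2) and B = Suc.prems(3)
  have bounded: "integrable N f \<and> \<bar>\<integral>y. f y \<partial>N\<bar> \<le> B" if "N \<in> space (prob_algebra (aug_space M))" for N
    using integrable_prob_algebra[OF that f B] abs_integral_prob_algebra_le[OF that f B] by simp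
  define K where "K \<rho> x = (\<integral>y. f y \<partial>aug_kernel M \<rho> x)" for \<rho> x
  have Kb: "\<bar>K \<rho> x\<bar> \<le> B" if "is_policy M \<rho>" "x \<in> space (aug_space M)" for \<rho> x
    unfolding K_def using bounded[OF measurable_space[OF measurable_aug_kernel[OF that(1)] that(2)]] by blast
  have Km: "K \<rho> \<in> borel_measurable (aug_space M)" if "is_policy M \<rho>" for \<rho>
    unfolding K_def[abs_def]
    by (rule measurable_compose[OF measurable_prob_algebraD[OF measurable_aug_kernel[OF that]]
          integral_measurable_subprob_algebra[OF f]])
  have step: "(\<integral>x. f x \<partial>aug_dist M \<rho> (Suc t)) = (\<integral>x. K \<rho> x \<partial>aug_dist M \<rho> t)" if "is_policy M \<rho>" for \<rho>
    unfolding K_def aug_dist_Suc[OF that t(2)]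
    by (rule integral_bind_integrable[OF f])
       (use bounded[OF aug_dist_in_space[OF that Suc.prems(1)]] in
         \<open>auto simp: aug_dist_Suc[OF that t(2)] measurable_aug_dist[OF that t(1)] measurable_prob_algebraD[OF measurable_aug_kernel[OF that]]\<close>)
  interpret prob_space "aug_dist M \<pi> t" by (rule prob_space_aug_dist[OF policies(1) t(1)])
  have Ki: "integrable (aug_dist M \<pi> t) (K \<rho>)" if "is_policy M \<rho>" for \<rho>
    by (rule integrable_const_bound[where B = B])
       (use Kb[OF that] Km[OF that] in \<open>auto intro!: AE_I2 simp: space_aug_dist[OF policies(1) t(1)] measurable_aug_dist[OF policies(1) t(1)]\<close>)
  \<comment> \<open>The second half of the hybrid: the state law is fixed to the old one and only
    the step changes.\<close>
  have "\<bar>(\<integral>x. K \<pi>' x \<partial>aug_dist M \<pi> t) - (\<integral>x. K \<pi> x \<partial>aug_dist M \<pi> t)\<bar>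
      = \<bar>\<integral>x. K \<pi>' x - K \<pi> x \<partial>aug_dist M \<pi> t\<bar>"
    using Ki policies by simp
  also have "\<dots> \<le> (\<integral>x. \<bar>K \<pi>' x - K \<pi> x\<bar> \<partial>aug_dist M \<pi> t)" by (rule integral_abs_bound)
  also have "\<dots> \<le> (\<integral>x. 2 * B * tv_at x \<partial>aug_dist M \<pi> t)"
  proof (rule integral_mono)
    show "integrable (aug_dist M \<pi> t) (\<lambda>x. \<bar>K \<pi>' x - K \<pi> x\<bar>)"
      using Ki policies by auto
    show "\<bar>K \<pi>' x - K \<pi> x\<bar> \<le> 2 * B * tv_at x" if "x \<in> space (aug_dist M \<pi> t)" for x
      using that f B unfolding K_def space_aug_dist[OF policies(1) t(1)] by (rule aug_kernel_diff)
  qed (use integrable_tv_at[OF t(1)] in simp)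
  also have "\<dots> = 2 * B * (\<integral>x. tv_at x \<partial>aug_dist M \<pi> t)" by simp
  finally have "\<bar>(\<integral>x. K \<pi>' x \<partial>aug_dist M \<pi> t) - (\<integral>x. K \<pi> x \<partial>aug_dist M \<pi> t)\<bar>
      \<le> 2 * B * (\<integral>x. tv_at x \<partial>aug_dist M \<pi> t)" .
  \<comment> \<open>The first half is the induction hypothesis with \<open>K \<pi>'\<close> in place
    of \<open>f\<close>; the triangle inequality adds the summand for \<open>j = t\<close>.\<close>
  with Suc.IH[OF t(1) Km[OF policies(2)] Kb[OF policies(2)]] show ?case
    by (simp add: step policies distrib_left)
qed

lemma total_tv_eq: "total_tv M \<pi> \<pi>' = (\<Sum>t<horizon M. \<integral>x. tv_at x \<partial>aug_dist M \<pi> t)"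
  by (simp add: total_tv_def)

lemma partial_tv_le: "t \<le> horizon M \<Longrightarrow> (\<Sum>j<t. \<integral>x. tv_at x \<partial>aug_dist M \<pi> j) \<le> total_tv M \<pi> \<pi>'"
  unfolding total_tv_eq by (intro sum_mono2) (auto intro: integral_tv_at_nonneg)

lemma total_tv_nonneg: "0 \<le> total_tv M \<pi> \<pi>'"
  using partial_tv_le[of 0] by simp

text \<open>Indicator functions are admissible in \<open>aug_dist_diff\<close> with
  \<open>B = 1\<close>, and the resulting bound is a multiple of a vanishing sum.\<close>

lemma aug_dist_eq_if_total_tv_0:
  assumes "total_tv M \<pi> \<pi>' = 0" and t: "t \<le> horizon M"
  shows "aug_dist M \<pi>' t = aug_dist M \<pi> t"
proof -
  interpret D: prob_space "aug_dist M \<pi> t" by (rule prob_space_aug_dist[OF policies(1) t])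
  interpret D': prob_space "aug_dist M \<pi>' t" by (rule prob_space_aug_dist[OF policies(2) t])
  note sets = sets_aug_dist[OF policies(1) t] sets_aug_dist[OF policies(2) t]
  show ?thesis
  proof (rule measure_eqI)
    fix A assume "A \<in> sets (aug_dist M \<pi>' t)"
    then have A: "A \<in> sets (aug_space M)" using sets by simp
    have "\<bar>(\<integral>x. indicator A x \<partial>aug_dist M \<pi>' t) - (\<integral>x. indicator A x \<partial>aug_dist M \<pi> t)\<bar>
        \<le> 2 * (1 :: real) * (\<Sum>j<t. \<integral>x. tv_at x \<partial>aug_dist M \<pi> j)"
      using A by (intro aug_dist_diff t) (auto simp: indicator_def)
    also have "\<dots> \<le> 0" using partial_tv_le[OF t] assms(1) by simp
    finally have "measure (aug_dist M \<pi>' t) A = measure (aug_dist M \<pi> t) A"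
      using A sets by simp
    then show "emeasure (aug_dist M \<pi>' t) A = emeasure (aug_dist M \<pi> t) A"
      by (simp add: D.emeasure_eq_measure D'.emeasure_eq_measure)
  qed (simp add: sets)
qed

section \<open>The risk of the new policy\<close>

lemma exp_adv_le_adv_bound:
  "t < horizon M \<Longrightarrow> x \<in> space (aug_space M) \<Longrightarrow> ennreal \<bar>exp_adv M h \<pi> \<pi>' t x\<bar> \<le> adv_bound M h \<pi> \<pi>'"
  unfolding adv_bound_def by (intro SUP_upper2[of t] SUP_upper) auto

theorem test_cost_le:
  assumes h: "h \<in> borel_measurable borel" and ex: "expectations_defined M h \<pi> \<pi>'"
    and c: "0 \<le> c" "2 * of_nat (horizon M) * adv_bound M h \<pi> \<pi>' * ennreal (total_tv M \<pi> \<pi>') \<le> ennreal c"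
  shows "test_cost M h \<pi>' \<le>
    test_cost M h \<pi> + (\<Sum>t<horizon M. \<integral>x. exp_adv M h \<pi> \<pi>' t x \<partial>aug_dist M \<pi> t) + c"
proof (cases "total_tv M \<pi> \<pi>' = 0")
  \<comment> \<open>Then \<open>adv_bound\<close> may be infinite, with \<open>\<infinity> * 0 = 0\<close> in the hypothesis on \<open>c\<close>.\<close>
  case True
  then have eq: "aug_dist M \<pi>' t = aug_dist M \<pi> t" if "t < horizon M" for t
    using that by (intro aug_dist_eq_if_total_tv_0) auto
  have "integrable (aug_dist M \<pi>' t) (exp_adv M h \<pi> \<pi>' t)" if "t < horizon M" for t
    using ex that unfolding expectations_defined_def eq[OF that] by simp
  from performance_difference[OF h ex this] show ?thesis
    using c(1) by (simp add: eq)
next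
  case False
  let ?tv = "total_tv M \<pi> \<pi>'" and ?g = "exp_adv M h \<pi> \<pi>'"
  have tv: "0 < ?tv" using False total_tv_nonneg by simp
  have H: "0 < horizon M" using is_cmdp by (simp add: is_cmdp_def)
  \<comment> \<open>With positive horizon and positive total variation, an infinite
    \<open>adv_bound\<close> would make the left side of the hypothesis on \<open>c\<close>
    infinite, while \<open>c\<close> is real.\<close>
  have "adv_bound M h \<pi> \<pi>' \<noteq> \<infinity>"
  proof
    assume "adv_bound M h \<pi> \<pi>' = \<infinity>"
    with c(2) tv H show False by (simp add: ennreal_mult_top ennreal_top_mult top_unique)
  qed
  then obtain B where B: "0 \<le> B" "adv_bound M h \<pi> \<pi>' = ennreal B"
    by (cases "adv_bound M h \<pi> \<pi>'") auto
  have "ennreal (2 * real (horizon M) * B * ?tv) \<le> ennreal c"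
    using c(2) B tv by (simp add: ennreal_mult'' ennreal_of_nat_eq_real_of_nat ennreal_mult)
  then have Bc: "2 * real (horizon M) * B * ?tv \<le> c"
    using c(1) by simp
  have gB: "\<bar>?g t x\<bar> \<le> B" if "t < horizon M" "x \<in> space (aug_space M)" for t x
    using exp_adv_le_adv_bound[OF that, of h] B by simp
  \<comment> \<open>Measurability is part of integrability under the old law, whose sigma-algebra is
    that of \<open>aug_space M\<close>.\<close>
  have gm: "?g t \<in> borel_measurable (aug_space M)" if "t < horizon M" for t
  proof -
    have "?g t \<in> borel_measurable (aug_dist M \<pi> t)"
      using ex that by (auto simp: expectations_defined_def)
    then show ?thesis using that by (simp add: measurable_aug_dist[OF policies(1)])
  qed
  have diff: "(\<integral>x. ?g t x \<partial>aug_dist M \<pi>' t) \<le> (\<integral>x. ?g t x \<partial>aug_dist M \<pi> t) + 2 * B * ?tv"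
    if t: "t < horizon M" for t
  proof -
    have "\<bar>(\<integral>x. ?g t x \<partial>aug_dist M \<pi>' t) - (\<integral>x. ?g t x \<partial>aug_dist M \<pi> t)\<bar>
        \<le> 2 * B * (\<Sum>j<t. \<integral>x. tv_at x \<partial>aug_dist M \<pi> j)"
      using t by (intro aug_dist_diff gm gB) auto
    also have "\<dots> \<le> 2 * B * ?tv"
      using B t partial_tv_le[of t] by (intro mult_left_mono) auto
    finally show ?thesis by simp
  qed
  \<comment> \<open>The bound \<open>B\<close> carries integrability over to the new law, a
    probability measure.\<close>
  have "integrable (aug_dist M \<pi>' t) (?g t)" if "t < horizon M" for t
    using that by (intro integrable_prob_algebra[OF aug_dist_in_space[OF policies(2)] gm gB]) auto
  from performance_difference[OF h ex this]
  have "test_cost M h \<pi>' = test_cost M h \<pi> + (\<Sum>t<horizon M. \<integral>x. ?g t x \<partial>aug_dist M \<pi>' t)" .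
  also have "(\<Sum>t<horizon M. \<integral>x. ?g t x \<partial>aug_dist M \<pi>' t) \<le>
      (\<Sum>t<horizon M. (\<integral>x. ?g t x \<partial>aug_dist M \<pi> t) + 2 * B * ?tv)"
    using diff by (intro sum_mono) auto
  also have "\<dots> \<le> (\<Sum>t<horizon M. \<integral>x. ?g t x \<partial>aug_dist M \<pi> t) + c"
    using Bc by (simp add: sum.distrib algebra_simps)
  finally show ?thesis by simp
qed

end

end

theorem theorem4p3:
  fixes M :: "('s, 'a) cmdp"
    and \<pi>\<^sub>k :: "'s \<Rightarrow> 'a measure"
    and \<H> :: "(real \<Rightarrow> real) set" and h :: "real \<Rightarrow> real"
    and \<epsilon> d \<delta> \<delta>\<^sub>K\<^sub>L :: real
    and R :: stein_setup
    and n :: nat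
    and \<Omega> :: "'w measure" and \<tau> :: "nat \<Rightarrow> 'w \<Rightarrow> ('s, 'a) traj"
    and \<pi>' :: "'w \<Rightarrow> 's \<Rightarrow> 'a measure" and lam :: "'w \<Rightarrow> real"
  assumes "is_cmdp M"
    and "is_policy M \<pi>\<^sub>k"
    and "is_stein_setup R"
    and "0 < d" and "0 < n" and "0 < \<delta>" and "\<delta> < 1" and "0 < \<delta>\<^sub>K\<^sub>L"
    and "iid_rollouts M \<pi>\<^sub>k n \<Omega> \<tau>"
    and "\<And>\<omega>. \<omega> \<in> space \<Omega> \<Longrightarrow> is_policy M (\<pi>' \<omega>)"
    and "\<And>\<omega>. \<omega> \<in> space \<Omega> \<Longrightarrow> 0 \<le> lam \<omega>"
    and "\<And>g. g \<in> \<H> \<Longrightarrow> g \<in> borel_measurable borel"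
    and "\<And>g \<omega>. g \<in> \<H> \<Longrightarrow> \<omega> \<in> space \<Omega> \<Longrightarrow> expectations_defined M g \<pi>\<^sub>k (\<pi>' \<omega>)"
    and "h \<in> \<H>"
  shows "\<exists>E\<in>sets \<Omega>. measure \<Omega> E \<ge> 1 - 2 * \<delta> \<and>
    (\<forall>\<omega>\<in>E.
       margined_constraint M h \<pi>\<^sub>k (\<pi>' \<omega>) (lam \<omega>) (SD_rollouts M R d \<delta> n (\<lambda>i. \<tau> i \<omega>)) \<epsilon> \<delta>\<^sub>K\<^sub>L \<longrightarrow>
       0 < SD_rollouts M R d \<delta> n (\<lambda>i. \<tau> i \<omega>) \<longrightarrow>
       ennreal (lam \<omega>) \<ge>
         2 * of_nat (horizon M) * adv_bound M h \<pi>\<^sub>k (\<pi>' \<omega>) * ennreal (total_tv M \<pi>\<^sub>k (\<pi>' \<omega>))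
           / ennreal (SD_rollouts M R d \<delta> n (\<lambda>i. \<tau> i \<omega>)) \<longrightarrow>
       test_cost M h (\<pi>' \<omega>) \<le> \<epsilon>)"
proof (intro bexI[of _ "space \<Omega>"] conjI ballI impI)
  have "prob_space \<Omega>" using assms by (simp add: iid_rollouts_def)
  then show "1 - 2 * \<delta> \<le> measure \<Omega> (space \<Omega>)"
    using \<open>0 < \<delta>\<close> by (simp add: prob_space.prob_space)
  fix \<omega> assume \<omega>: "\<omega> \<in> space \<Omega>"
  let ?SD = "SD_rollouts M R d \<delta> n (\<lambda>i. \<tau> i \<omega>)"
  let ?bound = "2 * of_nat (horizon M) * adv_bound M h \<pi>\<^sub>k (\<pi>' \<omega>) * ennreal (total_tv M \<pi>\<^sub>k (\<pi>' \<omega>))"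
  assume constr: "margined_constraint M h \<pi>\<^sub>k (\<pi>' \<omega>) (lam \<omega>) ?SD \<epsilon> \<delta>\<^sub>K\<^sub>L"
    and SD: "0 < ?SD" and lam: "?bound / ennreal ?SD \<le> ennreal (lam \<omega>)"
  interpret cmdp M by standard fact
  \<comment> \<open>Division can be undone in the extended reals because \<open>?SD\<close> is
    positive and finite, even if \<open>?bound\<close> is infinite.\<close>
  have "?bound = ?bound / ennreal ?SD * ennreal ?SD"
    using SD by (subst ennreal_divide_times) (simp add: ennreal_divide_self)
  also have "\<dots> \<le> ennreal (lam \<omega>) * ennreal ?SD"
    using lam by (rule mult_right_mono) simp
  \<comment> \<open>\<open>assms(11)\<close> is the nonnegativity of the Stein factor; a negative
    one would be cut off to 0 by \<open>ennreal\<close>.\<close>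
  also have "\<dots> = ennreal (lam \<omega> * ?SD)"
    using SD assms(11)[OF \<omega>] by (simp add: ennreal_mult)
  finally have "?bound \<le> ennreal (lam \<omega> * ?SD)" .
  moreover have "0 \<le> lam \<omega> * ?SD" using SD assms(11)[OF \<omega>] by simp
  \<comment> \<open>The margin \<open>lam \<omega> * ?SD\<close> is taken for \<open>c\<close>,
    which makes the right side literally the left side of the constraint.\<close>
  ultimately have "test_cost M h (\<pi>' \<omega>) \<le> test_cost M h \<pi>\<^sub>k +
      (\<Sum>t<horizon M. \<integral>x. exp_adv M h \<pi>\<^sub>k (\<pi>' \<omega>) t x \<partial>aug_dist M \<pi>\<^sub>k t) + lam \<omega> * ?SD"
    using assms \<omega> by (intro test_cost_le) auto
  then show "test_cost M h (\<pi>' \<omega>) \<le> \<epsilon>"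
    using constr by (simp add: margined_constraint_def)
qed simp

end
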